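(* Let $N=N(\iota)$ be an increasing sequence and, for each $\iota$, let $\bm A,\bm B\in\mathbb{C}^{N\times N}$ be random orthogonal projection matrices. Suppose that for some $\alpha,\beta\in(0,1)$, $$\lim_{\iota\to\infty}\mathbb{E}\Big(\tfrac1N\operatorname{Tr}(\bm A)-\alpha\Big)^2=0,\qquad \lim_{\iota\to\infty}\mathbb{E}\Big(\tfrac1N\operatorname{Tr}(\bm B)-\beta\Big)^2=0,$$ and, for every integer $k\ge1$, $$\lim_{\iota\to\infty}\mathbb{E}\left(\frac1N\operatorname{Tr}\Big(\big((\bm A-\alpha\bm I_N)(\bm B-\beta\bm I_N)\big)^k\Big)\right)^2=0.$$ Then the empirical spectral distribution of $\bm A\bm B\bm A$ converges in probability to $\mathsf{MANOVA}(\alpha,\beta)$.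
   Context: For $\alpha,\beta\in(0,1)$, $\mathsf{MANOVA}(\alpha,\beta)$ is the probability measure on $\mathbb{R}$ $$d\mu(x)=\frac{\sqrt{(r_+-x)(x-r_-)}}{2\pi x(1-x)}\mathbf 1_{[r_-,r_+]}(x)\,dx+(1-\min\{\alpha,\beta\})\delta_0+\max\{\alpha+\beta-1,0\}\delta_1,$$ where $r_\pm=r_\pm(\alpha,\beta)=\big(\sqrt{\alpha(1-\beta)}\pm\sqrt{\beta(1-\alpha)}\big)^2$ and $\delta_c$ is the Dirac mass at $c$. The empirical spectral distribution (e.s.d.) of a Hermitian $N\times N$ matrix with eigenvalues $\lambda_1,\dots,\lambda_N$ is $\frac1N\sum_i\delta_{\lambda_i}$. Random probability measures $\mu_\iota$ converge in probability to a deterministic $\mu$ if for every continuous compactly supported $f:\mathbb{R}\to\mathbb{R}$, $\int f\,d\mu_\iota\to\int f\,d\mu$ in probability. *)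

theory Defs
  imports "HOL-Probability.Probability" "Jordan_Normal_Form.Schur_Decomposition"
begin

definition mat_trace :: "complex mat \<Rightarrow> complex" where
  "mat_trace A = (\<Sum>i<dim_row A. A $$ (i,i))"

definition orth_proj_mat :: "nat \<Rightarrow> complex mat \<Rightarrow> bool" where
  "orth_proj_mat n P \<longleftrightarrow> P \<in> carrier_mat n n \<and> mat_adjoint P = P \<and> P * P = P"

text \<open>Integral of f against the empirical spectral distribution of a square matrix:
  (1/N) * sum over the eigenvalues counted with (algebraic) multiplicity.
  For Hermitian matrices all eigenvalues are real, so Re is the identity on them.\<close>
definition esd_integral :: "complex mat \<Rightarrow> (real \<Rightarrow> real) \<Rightarrow> real" where
  "esd_integral A f =
     (\<Sum>z\<in>{z. poly (char_poly A) z = 0}. real (Polynomial.order z (char_poly A)) * f (Re z))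
       / real (dim_row A)"

definition manova_rminus :: "real \<Rightarrow> real \<Rightarrow> real" where
  "manova_rminus a b = (sqrt (a * (1 - b)) - sqrt (b * (1 - a)))\<^sup>2"

definition manova_rplus :: "real \<Rightarrow> real \<Rightarrow> real" where
  "manova_rplus a b = (sqrt (a * (1 - b)) + sqrt (b * (1 - a)))\<^sup>2"

definition manova_density :: "real \<Rightarrow> real \<Rightarrow> real \<Rightarrow> real" where
  "manova_density a b x =
     sqrt ((manova_rplus a b - x) * (x - manova_rminus a b)) / (2 * pi * x * (1 - x))"

definition manova_integral :: "real \<Rightarrow> real \<Rightarrow> (real \<Rightarrow> real) \<Rightarrow> real" where
  "manova_integral a b f =
     (\<integral>x\<in>{manova_rminus a b..manova_rplus a b}. manova_density a b x * f x \<partial>lborel)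
     + (1 - min a b) * f 0 + max (a + b - 1) 0 * f 1"

end

theory Submission
  imports Defs
begin

text \<open>
  Let \<open>C = (A - \<alpha>)(B - \<beta>)\<close> and let \<open>Z = 1 - A - B + AB + BA\<close>, which commutes with \<open>A\<close> and \<open>B\<close>.
  Since \<open>Z - m = C + (B - 1 + \<beta>)(A - 1 + \<alpha>)\<close> with \<open>m = \<alpha> + \<beta> - 2\<alpha>\<beta>\<close> and
  \<open>(A - 1 + \<alpha>)(A - \<alpha>) = \<alpha>(1 - \<alpha>)\<close>, one has \<open>C\<^sup>2 = (Z - m) C - q\<close> with \<open>q = \<alpha>(1 - \<alpha>)\<beta>(1 - \<beta>)\<close>.
  Hence \<open>Tr C\<^sup>k\<close> equals \<open>Tr P\<^sub>k(ABA)\<close>, for the Chebyshev polynomial \<open>P\<^sub>k\<close> of the interval \<open>[r\<^sub>-, r\<^sub>+]\<close>,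
  up to an explicit combination of \<open>Tr A\<close>, \<open>Tr B\<close> and \<open>N\<close>. The hypotheses therefore determine the limit
  of every Chebyshev moment of the spectral distribution. The substitution \<open>x = m - 2 \<surd>q cos \<theta>\<close> turns the
  Chebyshev moments of the MANOVA density into Fourier coefficients of
  \<open>sin\<^sup>2 \<theta> / (1 - 2 r cos \<theta> + r\<^sup>2)\<close>, and they agree with these limits. Since all eigenvalues of \<open>ABA\<close> lie
  in \<open>[0, 1]\<close>, Weierstrass approximation extends the convergence to continuous functions.
\<close>

text \<open>\<open>Tr C^k\<close> is not a function of the spectrum of \<open>A * B * A\<close>
  alone. On a two-dimensional block of the pair the eigenvalues y, z of \<open>C\<close> satisfy y +
  z = c - m and y z = q, where c is the squared cosine, so the block contributes P_k(c). But
  \<open>A * B * A\<close> has the further eigenvalue 0 there, and a one-dimensional block carries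
  only one of the two roots. The correction by \<open>Tr A\<close>, \<open>Tr B\<close> and
  \<open>N\<close> repairs exactly this. No block decomposition is carried out: the relation for
  \<open>C\<close> squared is multiplied by powers of \<open>Z\<close> and traced, which leaves a
  recurrence in two indices. On the side of the limit law, the closed form of the Fourier
  coefficients requires \<bar>r\<bar> \<le> 1. Hence the integral of the density depends on the
  order of \<alpha> and \<beta> and on the sign of \<alpha> + \<beta> - 1. The minimum and maximum
  in the weights of the two atoms compensate for this, and the total is one formula for all
  parameters.\<close>

lemma mat_trace_add:
  assumes "X \<in> carrier_mat n n" "Y \<in> carrier_mat n n"
  shows "mat_trace (X + Y) = mat_trace X + mat_trace Y"
  using assms by (auto simp: mat_trace_def sum.distrib)

lemma mat_trace_minus:
  assumes "X \<in> carrier_mat n n" "Y \<in> carrier_mat n n"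
  shows "mat_trace (X - Y) = mat_trace X - mat_trace Y"
  using assms by (auto simp: mat_trace_def sum_subtractf)

lemma mat_trace_smult:
  assumes "X \<in> carrier_mat n n"
  shows "mat_trace (c \<cdot>\<^sub>m X) = c * mat_trace X"
  using assms by (auto simp: mat_trace_def sum_distrib_left)

lemma mat_trace_one: "mat_trace (1\<^sub>m n) = of_nat n"
  by (simp add: mat_trace_def)

lemma mat_trace_comm:
  assumes "X \<in> carrier_mat n n" "Y \<in> carrier_mat n n"
  shows "mat_trace (X * Y) = mat_trace (Y * X)"
proof -
  have "mat_trace (X * Y) = (\<Sum>i<n. \<Sum>j<n. X $$ (i,j) * Y $$ (j,i))"
    using assms by (auto simp: mat_trace_def scalar_prod_def atLeast0LessThan intro!: sum.cong)
  also have "\<dots> = (\<Sum>j<n. \<Sum>i<n. Y $$ (j,i) * X $$ (i,j))"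
    by (subst sum.swap) (simp add: mult.commute)
  also have "\<dots> = mat_trace (Y * X)"
    using assms by (auto simp: mat_trace_def scalar_prod_def atLeast0LessThan intro!: sum.cong)
  finally show ?thesis .
qed

text \<open>\<open>cheb m q k (m + 2 \<surd>q cos \<theta>) = 2 q\<^sup>k\<^sup>/\<^sup>2 cos (k \<theta>)\<close>: rescaled Chebyshev polynomials, equal to
  \<open>y\<^sup>k + z\<^sup>k\<close> for the roots \<open>y, z\<close> of \<open>t\<^sup>2 - (x - m) t + q\<close>.\<close>
fun cheb :: "real \<Rightarrow> real \<Rightarrow> nat \<Rightarrow> real \<Rightarrow> real" where
  "cheb m q 0 x = 2"
| "cheb m q (Suc 0) x = x - m"
| "cheb m q (Suc (Suc k)) x = (x - m) * cheb m q (Suc k) x - q * cheb m q k x"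

section \<open>Trace identities for two projections\<close>

locale two_projections =
  fixes n :: nat and A B :: "complex mat"
  assumes A[simp]: "A \<in> carrier_mat n n" and B[simp]: "B \<in> carrier_mat n n"
    and AA[simp]: "A * A = A" and BB[simp]: "B * B = B"
begin

text \<open>\<open>Z\<close> is central in the algebra generated by \<open>A\<close> and \<open>B\<close>; on a two-dimensional block where the
  ranges meet at angle \<open>\<phi>\<close> it acts as \<open>cos\<^sup>2 \<phi>\<close>.\<close>
definition Z where "Z = 1\<^sub>m n - A - B + A * B + B * A"

lemma Z[simp]: "Z \<in> carrier_mat n n"
  unfolding Z_def by (intro add_carrier_mat minus_carrier_mat mult_carrier_mat[of _ n n _ n] A B)

lemma dims[simp]: "dim_row A = n" "dim_col A = n" "dim_row B = n" "dim_col B = n"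
  by (rule carrier_matD[OF A] carrier_matD[OF B])+

lemma dims_Z[simp]: "dim_row Z = n" "dim_col Z = n"
  by (rule carrier_matD[OF Z])+

lemmas assoc = assoc_mult_mat[of _ n n _ n _ n]

lemma AAX: "X \<in> carrier_mat n n \<Longrightarrow> A * (A * X) = A * X"
  using assoc_mult_mat[of A n n A n X n] by simp

lemma BBX: "X \<in> carrier_mat n n \<Longrightarrow> B * (B * X) = B * X"
  using assoc_mult_mat[of B n n B n X n] by simp

lemmas expand = minus_mult_distrib_mat[of _ n n _ _ n] mult_minus_distrib_mat[of _ n n _ n]
  add_mult_distrib_mat[of _ n n _ _ n] mult_add_distrib_mat[of _ n n _ n]
  mult_smult_distrib[of _ n n _ n] mult_smult_assoc_mat[of _ n n _ n]
  left_mult_one_mat[of _ n n] right_mult_one_mat[of _ n n]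
  minus_carrier_mat mult_carrier_mat[of _ n n _ n] add_carrier_mat assoc AAX BBX

lemma Z_A: "Z * A = A * B * A"
  unfolding Z_def by (simp add: expand) (intro eq_matI, auto simp del: index_mult_mat(1))

lemma A_Z: "A * Z = A * B * A"
  unfolding Z_def by (simp add: expand) (intro eq_matI, auto simp del: index_mult_mat(1))

lemma Z_B: "Z * B = B * A * B"
  unfolding Z_def by (simp add: expand) (intro eq_matI, auto simp del: index_mult_mat(1))

lemma B_Z: "B * Z = B * A * B"
  unfolding Z_def by (simp add: expand) (intro eq_matI, auto simp del: index_mult_mat(1))


lemma comm_pow:
  assumes X: "X \<in> carrier_mat n n" and Y: "Y \<in> carrier_mat n n" and "X * Y = Y * X"
  shows "X ^\<^sub>m k * Y = Y * X ^\<^sub>m k"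
proof (induction k)
  case (Suc k)
  have "X ^\<^sub>m Suc k * Y = X ^\<^sub>m k * (X * Y)"
    using X Y by (simp add: assoc)
  also have "\<dots> = X ^\<^sub>m k * Y * X"
    using X Y by (simp add: assoc assms)
  also have "\<dots> = Y * X ^\<^sub>m Suc k"
    using X Y by (simp add: Suc assoc)
  finally show ?case .
qed (use X Y in simp)

lemma Zpow_A: "Z ^\<^sub>m j * A = A * Z ^\<^sub>m j"
  by (rule comm_pow) (simp_all add: Z_A A_Z)

lemma Zpow_B: "Z ^\<^sub>m j * B = B * Z ^\<^sub>m j"
  by (rule comm_pow) (simp_all add: Z_B B_Z)

text \<open>The single unknown to which every other trace reduces; it turns out to be the moment of
  order \<open>j + 1\<close> of \<open>A * B * A\<close>.\<close>

definition corner_trace where "corner_trace j = mat_trace (Z ^\<^sub>m j * (A * B))"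

lemma tr_BA: "mat_trace (Z ^\<^sub>m j * (B * A)) = corner_trace j"
proof -
  have "mat_trace (Z ^\<^sub>m j * (B * A)) = mat_trace ((Z ^\<^sub>m j * B) * A)"
    by (simp add: assoc)
  also have "\<dots> = mat_trace (A * (Z ^\<^sub>m j * B))"
    by (rule mat_trace_comm[of _ n]) (simp_all add: mult_carrier_mat[of _ n n _ n])
  also have "A * (Z ^\<^sub>m j * B) = (A * Z ^\<^sub>m j) * B"
    by (simp add: assoc)
  also have "\<dots> = Z ^\<^sub>m j * (A * B)"
    by (simp add: assoc flip: Zpow_A)
  finally show ?thesis by (simp add: corner_trace_def)
qed

text \<open>One factor \<open>Z\<close> is spent through \<open>Z * A = A * B * A\<close>. Cyclicity
  then moves the outer \<open>A\<close> next to the other one, and idempotence absorbs it.\<close>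

lemma tr_Suc_A: "mat_trace (Z ^\<^sub>m Suc j * A) = corner_trace j"
proof -
  have "mat_trace (Z ^\<^sub>m Suc j * A) = mat_trace ((Z ^\<^sub>m j * A * B) * A)"
    by (simp add: assoc Z_A mult_carrier_mat[of _ n n _ n])
  also have "\<dots> = mat_trace (A * (Z ^\<^sub>m j * A * B))"
    by (rule mat_trace_comm[of _ n]) (simp_all add: mult_carrier_mat[of _ n n _ n])
  also have "A * (Z ^\<^sub>m j * A * B) = A * (A * Z ^\<^sub>m j * B)"
    by (simp only: Zpow_A)
  also have "\<dots> = Z ^\<^sub>m j * A * B"
    by (simp add: assoc AAX Zpow_A mult_carrier_mat[of _ n n _ n])
  finally show ?thesis by (simp add: corner_trace_def assoc)
qed

lemma tr_Suc_B: "mat_trace (Z ^\<^sub>m Suc j * B) = corner_trace j"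
proof -
  have "mat_trace (Z ^\<^sub>m Suc j * B) = mat_trace ((Z ^\<^sub>m j * B * A) * B)"
    by (simp add: assoc Z_B mult_carrier_mat[of _ n n _ n])
  also have "\<dots> = mat_trace (B * (Z ^\<^sub>m j * B * A))"
    by (rule mat_trace_comm[of _ n]) (simp_all add: mult_carrier_mat[of _ n n _ n])
  also have "B * (Z ^\<^sub>m j * B * A) = B * (B * Z ^\<^sub>m j * A)"
    by (simp only: Zpow_B)
  also have "\<dots> = Z ^\<^sub>m j * B * A"
    by (simp add: assoc BBX Zpow_B mult_carrier_mat[of _ n n _ n])
  also have "\<dots> = Z ^\<^sub>m j * (B * A)"
    by (simp add: assoc)
  finally show ?thesis by (simp only: tr_BA)
qed

lemma tr_Z_Suc:
  "mat_trace (Z ^\<^sub>m Suc j) = mat_trace (Z ^\<^sub>m j) - mat_trace (Z ^\<^sub>m j * A) - mat_trace (Z ^\<^sub>m j * B) + 2 * corner_trace j"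
proof -
  have "Z ^\<^sub>m Suc j = Z ^\<^sub>m j - Z ^\<^sub>m j * A - Z ^\<^sub>m j * B + Z ^\<^sub>m j * (A * B) + Z ^\<^sub>m j * (B * A)"
    by (simp add: expand del: assoc_mult_mat, subst (2) Z_def, simp add: expand)
  then show ?thesis
    by (simp add: mat_trace_add[of _ n] mat_trace_minus[of _ n] expand tr_BA
        corner_trace_def[symmetric] del: pow_mat.simps)
qed

text \<open>\<open>A * B * A\<close> is the compression of the central element \<open>Z\<close> to
  the range of \<open>A\<close>. At exponent 0 the two sides would be \<open>A\<close> and the
  identity, hence the \<open>Suc\<close>.\<close>

lemma Zpow_A_eq: "Z ^\<^sub>m Suc j * A = (A * B * A) ^\<^sub>m Suc j"
proof (induction j)
  case 0
  then show ?case by (simp add: Z_A expand)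
next
  case (Suc j)
  have "Z ^\<^sub>m Suc (Suc j) * A = Z ^\<^sub>m Suc j * (A * (A * B * A))"
    by (simp add: expand Z_A)
  also have "\<dots> = (Z ^\<^sub>m Suc j * A) * (A * B * A)"
    by (simp add: expand)
  also have "\<dots> = (A * B * A) ^\<^sub>m Suc (Suc j)"
    by (subst Suc) simp
  finally show ?case .
qed

lemma tr_ABA_pow: "mat_trace ((A * B * A) ^\<^sub>m Suc j) = corner_trace j"
  by (simp only: flip: Zpow_A_eq tr_Suc_A)

definition C where "C a b = (A - a \<cdot>\<^sub>m 1\<^sub>m n) * (B - b \<cdot>\<^sub>m 1\<^sub>m n)"

lemma C[simp]: "C a b \<in> carrier_mat n n"
  unfolding C_def by (simp add: expand)

lemma dims_C[simp]: "dim_row (C a b) = n" "dim_col (C a b) = n"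
  by (rule carrier_matD[OF C])+

text \<open>Expand (t - 1 + a)(t - a) = t^2 - t + a (1 - a) and use that \<open>P\<close> is
  idempotent. The two shifts are thus inverse to each other up to a scalar, so the second summand in
  \<open>Z_eq\<close> inverts \<open>C a b\<close> up to a scalar.\<close>

lemma shifted_proj_mult:
  fixes P :: "complex mat"
  assumes P: "P \<in> carrier_mat n n" "P * P = P"
  shows "(P - (1 - a) \<cdot>\<^sub>m 1\<^sub>m n) * (P - a \<cdot>\<^sub>m 1\<^sub>m n) = (a * (1 - a)) \<cdot>\<^sub>m 1\<^sub>m n"
  using P by (simp add: expand) (intro eq_matI, auto simp: algebra_simps simp del: index_mult_mat(1))

lemma Z_eq:
  "Z = C a b + (B - (1 - b) \<cdot>\<^sub>m 1\<^sub>m n) * (A - (1 - a) \<cdot>\<^sub>m 1\<^sub>m n) + (a + b - 2 * a * b) \<cdot>\<^sub>m 1\<^sub>m n"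
  unfolding Z_def C_def
  by (simp add: expand) (intro eq_matI, auto simp: algebra_simps simp del: index_mult_mat(1))

text \<open>This is the Cayley--Hamilton theorem on every block simultaneously.\<close>
lemma C_square:
  "C a b * C a b = Z * C a b - (a + b - 2 * a * b) \<cdot>\<^sub>m C a b - (a * (1 - a) * b * (1 - b)) \<cdot>\<^sub>m 1\<^sub>m n"
proof -
  let ?a' = "A - (1 - a) \<cdot>\<^sub>m 1\<^sub>m n" and ?b' = "B - (1 - b) \<cdot>\<^sub>m 1\<^sub>m n"
  let ?a = "A - a \<cdot>\<^sub>m 1\<^sub>m n" and ?b = "B - b \<cdot>\<^sub>m 1\<^sub>m n"
  have c: "?a' \<in> carrier_mat n n" "?b' \<in> carrier_mat n n" "?a \<in> carrier_mat n n" "?b \<in> carrier_mat n n"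
    by (simp_all add: minus_carrier_mat)
  have "?b' * ?a' * C a b = ?b' * ((?a' * ?a) * ?b)"
    unfolding C_def using c by (simp only: assoc mult_carrier_mat[of _ n n _ n])
  also have "\<dots> = (a * (1 - a)) \<cdot>\<^sub>m (?b' * ?b)"
    unfolding shifted_proj_mult[OF A AA]
    using c by (simp only: mult_smult_distrib[of _ n n _ n] mult_smult_assoc_mat[of _ n n _ n]
        one_carrier_mat left_mult_one_mat[of _ n n])
  also have "\<dots> = (a * (1 - a) * b * (1 - b)) \<cdot>\<^sub>m 1\<^sub>m n"
    unfolding shifted_proj_mult[OF B BB] by (intro eq_matI) auto
  finally have *: "?b' * ?a' * C a b = (a * (1 - a) * b * (1 - b)) \<cdot>\<^sub>m 1\<^sub>m n" .
  have "Z * C a b = C a b * C a b + ?b' * ?a' * C a b + (a + b - 2 * a * b) \<cdot>\<^sub>m C a b"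
    using c by (subst Z_eq[of a b]) (simp only: add_mult_distrib_mat[of _ n n _ _ n]
        mult_smult_assoc_mat[of _ n n _ n] left_mult_one_mat[of _ n n] C one_carrier_mat
        smult_carrier_mat add_carrier_mat mult_carrier_mat[of _ n n _ n])
  then show ?thesis
    unfolding * by (intro eq_matI) (auto simp del: index_mult_mat(1))
qed

text \<open>Only \<open>j = 0\<close> is wanted in the end. The power of \<open>Z\<close> is carried
  along because the quadratic relation for \<open>C a b\<close> trades a factor \<open>C a b\<close>
  for a factor \<open>Z\<close>.\<close>

definition mixed_trace where "mixed_trace a b j k = mat_trace (Z ^\<^sub>m j * C a b ^\<^sub>m k)"

lemma mixed_trace_Suc_Suc:
  "mixed_trace a b j (Suc (Suc k)) = mixed_trace a b (Suc j) (Suc k) - (a + b - 2 * a * b) * mixed_trace a b j (Suc k)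
     - a * (1 - a) * b * (1 - b) * mixed_trace a b j k"
proof -
  let ?C = "C a b" and ?m = "a + b - 2 * a * b" and ?q = "a * (1 - a) * b * (1 - b)"
  note cl = mult_carrier_mat[of _ n n _ n] minus_carrier_mat pow_carrier_mat smult_carrier_mat
    one_carrier_mat C Z
  have CS: "?C ^\<^sub>m Suc k = ?C * ?C ^\<^sub>m k"
    using comm_pow[of ?C ?C k] by simp
  have "?C ^\<^sub>m Suc (Suc k) = (?C * ?C) * ?C ^\<^sub>m k"
    using comm_pow[of ?C ?C k] by (simp add: assoc)
  also have "\<dots> = Z * ?C ^\<^sub>m Suc k - ?m \<cdot>\<^sub>m ?C ^\<^sub>m Suc k - ?q \<cdot>\<^sub>m ?C ^\<^sub>m k"
    unfolding C_square CS
    by (simp only: minus_mult_distrib_mat[of _ n n _ _ n] mult_smult_assoc_mat[of _ n n _ n]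
        left_mult_one_mat[of _ n n] assoc cl)
  finally have "Z ^\<^sub>m j * ?C ^\<^sub>m Suc (Suc k) = Z ^\<^sub>m Suc j * ?C ^\<^sub>m Suc k - ?m \<cdot>\<^sub>m (Z ^\<^sub>m j * ?C ^\<^sub>m Suc k)
       - ?q \<cdot>\<^sub>m (Z ^\<^sub>m j * ?C ^\<^sub>m k)"
    by (simp only: mult_minus_distrib_mat[of _ n n _ n] mult_smult_distrib[of _ n n _ n] assoc cl
        pow_mat.simps(2)[of Z])
  then show ?thesis unfolding mixed_trace_def
    by (simp only: mat_trace_minus[of _ n] mat_trace_smult[of _ n] cl)
qed

lemma mixed_trace_0: "mixed_trace a b j 0 = mat_trace (Z ^\<^sub>m j)"
  by (simp add: mixed_trace_def right_mult_one_mat[of _ n n] del: right_mult_one_mat')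

lemma mixed_trace_1: "mixed_trace a b j (Suc 0) = corner_trace j - a * mat_trace (Z ^\<^sub>m j * B) - b * mat_trace (Z ^\<^sub>m j * A)
   + a * b * mat_trace (Z ^\<^sub>m j)"
proof -
  have "C a b = A * B - b \<cdot>\<^sub>m A - a \<cdot>\<^sub>m B + (a * b) \<cdot>\<^sub>m 1\<^sub>m n"
    unfolding C_def by (simp add: expand)
      (intro eq_matI, auto simp: algebra_simps simp del: index_mult_mat(1))
  then have "Z ^\<^sub>m j * C a b = Z ^\<^sub>m j * (A * B) - b \<cdot>\<^sub>m (Z ^\<^sub>m j * A) - a \<cdot>\<^sub>m (Z ^\<^sub>m j * B)
      + (a * b) \<cdot>\<^sub>m Z ^\<^sub>m j"
    by (simp add: expand)
  then show ?thesis
    by (simp add: mixed_trace_def corner_trace_def mat_trace_add[of _ n] mat_trace_minus[of _ n] mat_trace_smult[of _ n] expand)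
qed

text \<open>In \<open>tr_Z_Suc\<close> the traces against \<open>A\<close> and \<open>B\<close> both
  become the preceding \<open>corner_trace\<close> and cancel twice that term. The constant left
  over is the dimension of the common kernel minus that of the common range.\<close>

lemma tr_Z_pow: "mat_trace (Z ^\<^sub>m Suc j) = 2 * corner_trace j + of_nat n - mat_trace A - mat_trace B"
proof (induction j)
  case 0
  show ?case unfolding tr_Z_Suc[of 0] by (simp add: mat_trace_one left_mult_one_mat[of _ n n])
next
  case (Suc j)
  show ?case unfolding tr_Z_Suc[of "Suc j"] Suc tr_Suc_A tr_Suc_B by simp
qed

text \<open>Both sides satisfy the recurrence \<open>mixed_trace_Suc_Suc\<close> and agree for
  \<open>k = 0\<close> and \<open>k = 1\<close>. The induction keeps \<open>j\<close> arbitrary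
  since the recurrence raises it. The terms present only for \<open>j = 0\<close> belong to the
  value 0 of \<open>Z\<close>, which positive powers of \<open>Z\<close> annihilate.\<close>

lemma mixed_trace_eq:
  fixes a b :: real
  assumes xs: "\<And>j. mat_trace ((A * B * A) ^\<^sub>m j) = of_real (\<Sum>x\<leftarrow>xs. x ^ j)"
  defines "P \<equiv> cheb (a + b - 2 * a * b) (a * (1 - a) * b * (1 - b))"
  shows "mixed_trace a b j k = of_real (\<Sum>x\<leftarrow>xs. x ^ j * P k x)
     + (of_nat n - mat_trace A - mat_trace B) * of_real ((a * b) ^ k)
     + (if j = 0 then (mat_trace A - of_nat n) * of_real ((- (1 - a) * b) ^ k)
          + (mat_trace B - of_nat n) * of_real ((- a * (1 - b)) ^ k) else 0)"
  (is "_ = ?R j k")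
proof -
  define S :: "(real \<Rightarrow> real) \<Rightarrow> complex" where "S f = of_real (\<Sum>x\<leftarrow>xs. f x)" for f
  have S_add: "S (\<lambda>x. f x + g x) = S f + S g"
    and S_diff: "S (\<lambda>x. f x - g x) = S f - S g"
    and S_mult: "S (\<lambda>x. c * f x) = of_real c * S f" for f g c
    by (simp_all add: S_def sum_list_addf sum_list_subtractf sum_list_const_mult)
  have X: "corner_trace j = S (\<lambda>x. x ^ Suc j)" for j
    using xs[of "Suc j"] unfolding tr_ABA_pow S_def .
  have "of_nat n = S (\<lambda>x. 1)"
    using xs[of 0] by (simp add: S_def mat_trace_one mult_carrier_mat[of _ n n _ n])
  then have n: "S (\<lambda>x. c) = of_real c * of_nat n" for c
    using S_mult[of c "\<lambda>x. 1"] by simp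
  note R_def = S_def[symmetric]
  have k0: "mixed_trace a b j 0 = ?R j 0" for j
  proof (cases j)
    case 0
    have "mixed_trace a b 0 0 = of_nat n" by (simp add: mixed_trace_0 mat_trace_one)
    then show ?thesis using 0 by (simp add: R_def n P_def)
  next
    case (Suc i)
    have "S (\<lambda>x. x ^ Suc i * P 0 x) = 2 * corner_trace i"
      using S_mult[of 2 "\<lambda>x. x ^ Suc i"] by (simp add: P_def X mult.commute)
    then show ?thesis using Suc unfolding R_def mixed_trace_0 by (simp add: tr_Z_pow del: pow_mat.simps power_Suc)
  qed
  have k1: "mixed_trace a b j (Suc 0) = ?R j (Suc 0)" for j
  proof (cases j)
    case 0
    have "S (\<lambda>x. x ^ 0 * P (Suc 0) x) = corner_trace 0 - of_real (a + b - 2 * a * b) * of_nat n"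
      unfolding X n[symmetric] S_diff[symmetric] P_def by simp
    then show ?thesis using 0 unfolding R_def mixed_trace_1
      by (simp add: mat_trace_one left_mult_one_mat[of _ n n]) (simp add: algebra_simps)
  next
    case (Suc i)
    have "S (\<lambda>x. x ^ Suc i * P (Suc 0) x) = corner_trace (Suc i) - of_real (a + b - 2 * a * b) * corner_trace i"
      unfolding X S_mult[symmetric] S_diff[symmetric] P_def by (simp add: algebra_simps)
    then show ?thesis using Suc unfolding R_def mixed_trace_1
      by (simp add: tr_Z_pow tr_Suc_A tr_Suc_B del: pow_mat.simps power_Suc) (simp add: algebra_simps)
  qed
  show ?thesis
  proof (induction k arbitrary: j rule: induct_nat_012)
    case (ge2 k)
    have "S (\<lambda>x. x ^ j * P (Suc (Suc k)) x) = S (\<lambda>x. x ^ Suc j * P (Suc k) x)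
        - of_real (a + b - 2 * a * b) * S (\<lambda>x. x ^ j * P (Suc k) x)
        - of_real (a * (1 - a) * b * (1 - b)) * S (\<lambda>x. x ^ j * P k x)"
      unfolding S_mult[symmetric] S_diff[symmetric] P_def by (simp add: algebra_simps)
    \<comment> \<open>Each base solves y^2 = (z - m) y - q: with z = 1 for \<open>a * b\<close>,
      with z = 0 for the other two. Its powers therefore follow the same three-term
      recurrence.\<close>
    moreover have root: "complex_of_real (y ^ Suc (Suc k)) = of_real s * of_real (y ^ Suc k)
        - of_real (a * (1 - a) * b * (1 - b)) * of_real (y ^ k)"
      if "y ^ 2 = s * y - a * (1 - a) * b * (1 - b)" for y s
    proof -
      have "y ^ Suc (Suc k) = y ^ 2 * y ^ k" by (simp add: power2_eq_square)
      also have "\<dots> = s * y ^ Suc k - a * (1 - a) * b * (1 - b) * y ^ k"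
        unfolding that by (simp add: algebra_simps)
      finally show ?thesis by (metis of_real_diff of_real_mult)
    qed
    have "complex_of_real ((a * b) ^ Suc (Suc k)) =
        of_real (1 - (a + b - 2 * a * b)) * of_real ((a * b) ^ Suc k)
        - of_real (a * (1 - a) * b * (1 - b)) * of_real ((a * b) ^ k)"
      by (rule root) (simp add: algebra_simps power2_eq_square)
    moreover have "complex_of_real ((- (1 - a) * b) ^ Suc (Suc k)) =
        of_real (- (a + b - 2 * a * b)) * of_real ((- (1 - a) * b) ^ Suc k)
        - of_real (a * (1 - a) * b * (1 - b)) * of_real ((- (1 - a) * b) ^ k)"
      by (rule root) (simp add: algebra_simps power2_eq_square)
    moreover have "complex_of_real ((- a * (1 - b)) ^ Suc (Suc k)) =
        of_real (- (a + b - 2 * a * b)) * of_real ((- a * (1 - b)) ^ Suc k)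
        - of_real (a * (1 - a) * b * (1 - b)) * of_real ((- a * (1 - b)) ^ k)"
      by (rule root) (simp add: algebra_simps power2_eq_square)
    ultimately show ?case unfolding mixed_trace_Suc_Suc ge2 R_def
      by (cases "j = 0")
        (simp_all only: if_True if_False refl nat.distinct, simp_all add: algebra_simps del: of_real_power power_Suc)
  qed (use k0 k1 in auto)
qed

end

section \<open>Spectrum of a product of projections\<close>

lemma upper_triangular_mult:
  fixes S T :: "complex mat"
  assumes S: "S \<in> carrier_mat n n" "upper_triangular S" and T: "T \<in> carrier_mat n n" "upper_triangular T"
  shows "upper_triangular (S * T)" "\<And>i. i < n \<Longrightarrow> (S * T) $$ (i,i) = S $$ (i,i) * T $$ (i,i)"
proof -
  have entry: "(S * T) $$ (i,j) = (\<Sum>k<n. S $$ (i,k) * T $$ (k,j))" if "i < n" "j < n" for i j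
    using S T that by (auto simp: scalar_prod_def atLeast0LessThan intro!: sum.cong)
  have z: "S $$ (i,k) * T $$ (k,j) = 0" if "i < n" "k < n" "j \<le> i" "\<not> (k = i \<and> k = j)" for i j k
  proof (cases "k < i")
    case True
    then show ?thesis using S that by (auto dest: upper_triangularD)
  next
    case False
    then have "j < k" using that by auto
    then show ?thesis using T that by (auto dest: upper_triangularD)
  qed
  show "upper_triangular (S * T)"
  proof (rule upper_triangularI)
    fix i j assume "j < i" "i < dim_row (S * T)"
    then show "(S * T) $$ (i,j) = 0" using S(1) by (subst entry) (auto intro!: sum.neutral z)
  qed
  fix i assume i: "i < n"
  have "(\<Sum>k<n. S $$ (i,k) * T $$ (k,i)) = (\<Sum>k\<in>{i}. S $$ (i,k) * T $$ (k,i))"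
    using i z by (intro sum.mono_neutral_right) auto
  then show "(S * T) $$ (i,i) = S $$ (i,i) * T $$ (i,i)"
    using i by (simp add: entry)
qed

lemma upper_triangular_pow:
  fixes T :: "complex mat"
  assumes T: "T \<in> carrier_mat n n" "upper_triangular T"
  shows "upper_triangular (T ^\<^sub>m k) \<and> (\<forall>i<n. (T ^\<^sub>m k) $$ (i,i) = T $$ (i,i) ^ k)"
proof (induction k)
  case 0
  then show ?case using T by auto
next
  case (Suc k)
  then show ?case using upper_triangular_mult[OF pow_carrier_mat[OF T(1)] _ T] by (auto simp: mult.commute)
qed

lemma order_prod_linear:
  fixes es :: "complex list"
  shows "Polynomial.order z (\<Prod>e\<leftarrow>es. [:- e, 1:]) = count_list es z"
proof (induction es)
  case (Cons e es)
  have "(\<Prod>e\<leftarrow>es. [:- e, 1:]) \<noteq> 0"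
    by (auto simp: prod_list_zero_iff)
  moreover have "Polynomial.order z [:- e, 1:] = (if e = z then 1 else 0)"
    using order_power_n_n[of z 1] by (auto intro!: order_0I)
  ultimately show ?case using Cons by (auto simp: order_mult simp del: mult_pCons_left)
qed (auto intro!: order_0I)

lemma sum_list_map_eq_sum_count_list:
  fixes f :: "'a \<Rightarrow> real"
  assumes "finite S" "set xs \<subseteq> S"
  shows "(\<Sum>x\<leftarrow>xs. f x) = (\<Sum>x\<in>S. real (count_list xs x) * f x)"
  using assms(2)
proof (induction xs)
  case (Cons a xs)
  have "(\<Sum>x\<in>S. real (count_list (a # xs) x) * f x)
      = (\<Sum>x\<in>S. (if x = a then f x else 0) + real (count_list xs x) * f x)"
    by (intro sum.cong) (auto simp: algebra_simps)
  then show ?case using Cons assms(1) by (simp add: sum.distrib)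
qed simp

lemma esd_integral_factorized:
  assumes "char_poly H = (\<Prod>e\<leftarrow>es. [:- e, 1:])"
  shows "esd_integral H f = (\<Sum>e\<leftarrow>es. f (Re e)) / real (dim_row H)"
proof -
  have roots: "{z. poly (char_poly H) z = 0} = set es"
    unfolding assms by (auto simp: poly_prod_list prod_list_zero_iff)
  show ?thesis unfolding esd_integral_def roots
    by (simp add: assms order_prod_linear sum_list_map_eq_sum_count_list[of "set es" es])
qed

text \<open>Schur decomposition gives a similar upper triangular matrix with diagonal
  \<open>es\<close>. Powers of it have the powers of \<open>es\<close> on the diagonal, and the
  trace is invariant under similarity.\<close>

lemma mat_trace_pow_eigenvalues:
  fixes H :: "complex mat"
  assumes H: "H \<in> carrier_mat n n" and es: "char_poly H = (\<Prod>e\<leftarrow>es. [:- e, 1:])"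
  shows "mat_trace (H ^\<^sub>m k) = (\<Sum>e\<leftarrow>es. e ^ k)"
proof -
  obtain T P Q where "schur_decomposition H es = (T, P, Q)" by (metis prod_cases3)
  from schur_decomposition[OF H es this]
  have sim: "similar_mat_wit H T P Q" and ut: "upper_triangular T" and d: "diag_mat T = es" by auto
  note w = similar_mat_witD2[OF pow_carrier_mat[OF H] similar_mat_wit_pow[OF sim, of k]]
  have T: "T \<in> carrier_mat n n" using similar_mat_witD2[OF H sim] by auto
  have "mat_trace (H ^\<^sub>m k) = mat_trace (P * (T ^\<^sub>m k * Q))"
    using w T by (simp add: assoc_mult_mat[of _ n n _ n _ n])
  also have "\<dots> = mat_trace (T ^\<^sub>m k * Q * P)"
    using w T by (intro mat_trace_comm[of _ n]) (auto simp: mult_carrier_mat[of _ n n _ n])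
  also have "\<dots> = mat_trace (T ^\<^sub>m k)"
    using w T by (simp add: assoc_mult_mat[of _ n n _ n _ n])
  also have "\<dots> = (\<Sum>i<n. T $$ (i,i) ^ k)"
    using upper_triangular_pow[OF T ut, of k] T unfolding mat_trace_def by auto
  also have "\<dots> = (\<Sum>e\<leftarrow>es. e ^ k)"
    using T unfolding d[symmetric] diag_mat_def
    by (simp add: comp_def interv_sum_list_conv_sum_set_nat atLeast0LessThan)
  finally show ?thesis .
qed


section \<open>Hermitian inner product and the location of the eigenvalues\<close>

definition cip :: "complex vec \<Rightarrow> complex vec \<Rightarrow> complex" where
  "cip v w = (\<Sum>i<dim_vec v. v $ i * cnj (w $ i))"

lemma cip_self: "cip v v = of_real (\<Sum>i<dim_vec v. (cmod (v $ i))\<^sup>2)"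
  by (simp add: cip_def complex_norm_square del: of_real_power)

lemma orth_proj_matD:
  assumes "orth_proj_mat n P"
  shows "P \<in> carrier_mat n n" "P * P = P" "i < n \<Longrightarrow> j < n \<Longrightarrow> cnj (P $$ (i,j)) = P $$ (j,i)"
proof -
  show P: "P \<in> carrier_mat n n" "P * P = P" using assms by (auto simp: orth_proj_mat_def)
  assume ij: "i < n" "j < n"
  have "P $$ (j,i) = mat_adjoint P $$ (j,i)" using assms by (simp add: orth_proj_mat_def)
  also have "\<dots> = cnj (P $$ (i,j))" using ij P
    by (simp add: mat_adjoint_def mat_of_rows_def)
  finally show "cnj (P $$ (i,j)) = P $$ (j,i)" by simp
qed

lemma cip_orth_proj:
  assumes P: "orth_proj_mat n P" and v: "v \<in> carrier_vec n" and w: "w \<in> carrier_vec n"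
  shows "cip (P *\<^sub>v v) w = cip v (P *\<^sub>v w)"
proof -
  note PD = orth_proj_matD[OF P]
  have mv: "(P *\<^sub>v x) $ i = (\<Sum>j<n. P $$ (i,j) * x $ j)" if "i < n" "x \<in> carrier_vec n" for i x
    using that PD(1) by (auto simp: scalar_prod_def atLeast0LessThan intro!: sum.cong)
  have "cip (P *\<^sub>v v) w = (\<Sum>i<n. \<Sum>j<n. P $$ (i,j) * v $ j * cnj (w $ i))"
    using PD(1) v by (simp add: cip_def mv sum_distrib_right del: index_mult_mat_vec)
  also have "\<dots> = (\<Sum>j<n. \<Sum>i<n. P $$ (i,j) * v $ j * cnj (w $ i))"
    by (rule sum.swap)
  also have "\<dots> = (\<Sum>j<n. \<Sum>i<n. v $ j * (cnj (P $$ (j,i)) * cnj (w $ i)))"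
    by (intro sum.cong refl) (simp add: PD(3))
  also have "\<dots> = cip v (P *\<^sub>v w)"
    using PD(1) v w by (simp add: cip_def mv sum_distrib_left del: index_mult_mat_vec)
  finally show ?thesis .
qed

text \<open>Pythagoras: the difference of the two sides is the squared norm of
  \<open>v - P *\<^sub>v v\<close>.\<close>

lemma sqnorm_orth_proj_le:
  assumes P: "orth_proj_mat n P" and v: "v \<in> carrier_vec n"
  shows "Re (cip (P *\<^sub>v v) (P *\<^sub>v v)) \<le> Re (cip v v)"
proof -
  note PD = orth_proj_matD[OF P]
  have Pv: "P *\<^sub>v v \<in> carrier_vec n" using PD(1) v by simp
  have PPv: "P *\<^sub>v (P *\<^sub>v v) = P *\<^sub>v v"
    using PD v by (simp flip: assoc_mult_mat_vec)
  have 1: "cip (P *\<^sub>v v) v = cip (P *\<^sub>v v) (P *\<^sub>v v)"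
    using cip_orth_proj[OF P Pv v] PPv by simp
  have 2: "cip v (P *\<^sub>v v) = cip (P *\<^sub>v v) (P *\<^sub>v v)"
    using cip_orth_proj[OF P v Pv] PPv by simp
  have "cip (v - P *\<^sub>v v) (v - P *\<^sub>v v) = cip v v - cip v (P *\<^sub>v v) - cip (P *\<^sub>v v) v + cip (P *\<^sub>v v) (P *\<^sub>v v)"
    using v Pv PD(1) unfolding cip_def by (simp add: algebra_simps sum_subtractf sum.distrib)
  then have "cip (v - P *\<^sub>v v) (v - P *\<^sub>v v) = cip v v - cip (P *\<^sub>v v) (P *\<^sub>v v)"
    using 1 2 by simp
  moreover have "Re (cip (v - P *\<^sub>v v) (v - P *\<^sub>v v)) \<ge> 0"
    by (simp add: cip_self sum_nonneg del: of_real_sum)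
  ultimately show ?thesis by simp
qed

text \<open>For an eigenvector v, pairing the eigenvalue equation with v gives e |v|^2 = |B A v|^2,
  and this lies between 0 and |v|^2 because projections do not increase norms. Realness and both
  bounds follow at once.\<close>

lemma eigenvalue_proj_product:
  assumes A: "orth_proj_mat n A" and B: "orth_proj_mat n B" and e: "eigenvalue (A * B * A) e"
  shows "e = of_real (Re e)" "0 \<le> Re e" "Re e \<le> 1"
proof -
  note AD = orth_proj_matD[OF A] and BD = orth_proj_matD[OF B]
  obtain v where v: "v \<in> carrier_vec n" "v \<noteq> 0\<^sub>v n" "A * B * A *\<^sub>v v = e \<cdot>\<^sub>v v"
    using e AD(1) unfolding eigenvalue_def eigenvector_def by auto
  define x where "x = A *\<^sub>v v"
  define y where "y = B *\<^sub>v x"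
  have x: "x \<in> carrier_vec n" and y: "y \<in> carrier_vec n" using AD BD v by (auto simp: x_def y_def)
  have "B *\<^sub>v y = y" unfolding y_def using BD x by (simp flip: assoc_mult_mat_vec)
  have ev: "A *\<^sub>v y = e \<cdot>\<^sub>v v"
    using v AD BD unfolding x_def y_def by (simp add: assoc_mult_mat_vec[of _ n n _ n] mult_carrier_mat[of _ n n _ n])
  have "e * cip v v = cip (A *\<^sub>v y) v"
    unfolding ev using v by (simp add: cip_def sum_distrib_left mult.assoc)
  also have "\<dots> = cip (B *\<^sub>v y) x"
    unfolding x_def \<open>B *\<^sub>v y = y\<close> by (rule cip_orth_proj[OF A y v(1)])
  also have "\<dots> = cip y y"
    unfolding y_def using cip_orth_proj[OF B y x] \<open>B *\<^sub>v y = y\<close> y_def by simp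
  finally have eq: "e * cip v v = cip y y" .
  define r where "r = (\<Sum>i<dim_vec v. (cmod (v $ i))\<^sup>2)"
  define s where "s = (\<Sum>i<dim_vec y. (cmod (y $ i))\<^sup>2)"
  have rs: "cip v v = of_real r" "cip y y = of_real s" by (simp_all add: cip_self r_def s_def)
  have "r \<noteq> 0"
  proof
    assume "r = 0"
    then have "\<forall>i<n. v $ i = 0" using v by (auto simp: r_def sum_nonneg_eq_0_iff)
    then show False using v by auto
  qed
  moreover have "r \<ge> 0" "s \<ge> 0" by (auto simp: r_def s_def sum_nonneg)
  ultimately have "r > 0" by simp
  have "s \<le> r"
    using sqnorm_orth_proj_le[OF B x] sqnorm_orth_proj_le[OF A v(1)] rs by (simp flip: x_def y_def)
  have e: "e = of_real (s / r)"
    using eq \<open>r > 0\<close> unfolding rs by (simp add: field_simps)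
  show "e = of_real (Re e)" "0 \<le> Re e" "Re e \<le> 1"
    using \<open>r > 0\<close> \<open>s \<ge> 0\<close> \<open>s \<le> r\<close> by (simp_all add: e)
qed

text \<open>The interface to the spectral side: one real list serves both the spectral integral and
  the traces of powers, so later arguments need no eigenvalues.\<close>

lemma proj_product_spectrum:
  assumes A: "orth_proj_mat n A" and B: "orth_proj_mat n B"
  obtains xs :: "real list" where "length xs = n" "set xs \<subseteq> {0..1}"
    "\<And>f. esd_integral (A * B * A) f = (\<Sum>x\<leftarrow>xs. f x) / real n"
    "\<And>j. mat_trace ((A * B * A) ^\<^sub>m j) = of_real (\<Sum>x\<leftarrow>xs. x ^ j)"
proof -
  note AD = orth_proj_matD[OF A] and BD = orth_proj_matD[OF B]
  have H: "A * B * A \<in> carrier_mat n n" using AD BD by (simp add: mult_carrier_mat[of _ n n _ n])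
  obtain es where es: "char_poly (A * B * A) = (\<Prod>e\<leftarrow>es. [:- e, 1:])" "length es = n"
    using char_poly_factorized[OF H] by auto
  have ev: "e = of_real (Re e) \<and> 0 \<le> Re e \<and> Re e \<le> 1" if "e \<in> set es" for e
  proof -
    have "poly (char_poly (A * B * A)) e = 0"
      unfolding es(1) using that by (auto simp: poly_prod_list prod_list_zero_iff)
    then show ?thesis
      using eigenvalue_proj_product[OF A B] eigenvalue_root_char_poly[OF H] by blast
  qed
  show thesis
  proof (rule that[of "map Re es"])
    show "set (map Re es) \<subseteq> {0..1}" using ev by auto
    show "esd_integral (A * B * A) f = (\<Sum>x\<leftarrow>map Re es. f x) / real n" for f
      using esd_integral_factorized[OF es(1)] H AD by (simp add: comp_def)
    show "mat_trace ((A * B * A) ^\<^sub>m j) = of_real (\<Sum>x\<leftarrow>map Re es. x ^ j)" for j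
    proof -
      have "map (\<lambda>e. e ^ j) es = map (\<lambda>e. complex_of_real (Re e ^ j)) es"
        using ev by (metis (no_types, lifting) map_cong of_real_power)
      moreover have "of_real (\<Sum>e\<leftarrow>es. Re e ^ j) = (\<Sum>e\<leftarrow>es. complex_of_real (Re e ^ j))"
        by (induction es) auto
      ultimately show ?thesis
        unfolding mat_trace_pow_eigenvalues[OF H es(1)] by (simp only: map_map comp_def)
    qed
  qed (simp add: es)
qed

section \<open>Chebyshev moments of the MANOVA law\<close>

lemma has_integral_cos_multiple:
  "((\<lambda>x. cos (real k * x)) has_integral (if k = 0 then pi else 0)) {0..pi}"
proof (cases "k = 0")
  case True
  then show ?thesis using has_integral_const_real[of "1::real" 0 pi] by simp
next
  case False
  have "((\<lambda>x. cos (real k * x)) has_integral (sin (real k * pi) / k - sin (real k * 0) / k)) {0..pi}"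
    using False by (intro fundamental_theorem_of_calculus)
      (auto intro!: derivative_eq_intros simp flip: has_real_derivative_iff_has_vector_derivative)
  then show ?thesis using False by simp
qed

text \<open>Cosine coefficients of sin^2 x / (1 - 2 r cos x + r^2) on [0, pi]. They come from the
  Poisson kernel, whose coefficients are pi r^k: multiply by sin^2 x = (1 - cos 2x) / 2 and cancel 1
  - r^2.\<close>

fun poisson_coeff :: "real \<Rightarrow> nat \<Rightarrow> real" where
  "poisson_coeff r 0 = pi / 2"
| "poisson_coeff r (Suc 0) = pi * r / 4"
| "poisson_coeff r (Suc (Suc k)) = pi / 4 * (r ^ Suc (Suc k) - r ^ k)"

lemma cos_Suc_Suc_add: "cos (real (Suc (Suc k)) * x) + cos (real k * x) = 2 * cos x * cos (real (Suc k) * x)"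
proof -
  have "real (Suc (Suc k)) * x = real (Suc k) * x + x" "real k * x = real (Suc k) * x - x"
    by (simp_all add: algebra_simps)
  then show ?thesis by (simp only: cos_add cos_diff) simp
qed

lemma has_integral_cos_sin2:
  "((\<lambda>x. cos (real k * x) * (sin x)\<^sup>2) has_integral (if k = 0 then pi / 2 else if k = 2 then - pi / 4 else 0)) {0..pi}"
proof -
  have s2: "(sin x)\<^sup>2 = (1 - cos (2 * x)) / 2" for x :: real by (simp add: cos_double_sin)
  consider "k = 0" | "k = 1" | i where "k = Suc (Suc i)" by (metis One_nat_def old.nat.exhaust)
  then show ?thesis
  proof cases
    case 1
    have "((\<lambda>x. (cos (real 0 * x) - cos (real 2 * x)) / 2) has_integral (pi - 0) / 2) {0..pi}"
      using has_integral_cos_multiple[of 0] has_integral_cos_multiple[of 2]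
      by (intro has_integral_divide has_integral_diff) auto
    then show ?thesis using 1 by (simp add: s2)
  next
    case 2
    have "cos x * (sin x)\<^sup>2 = (cos (real 1 * x) - cos (real 3 * x)) / 4" for x
    proof -
      have "cos (real 3 * x) = 2 * cos x * cos (2 * x) - cos x"
        using cos_Suc_Suc_add[of 1 x] by simp
      then show ?thesis unfolding s2 by (simp add: field_simps)
    qed
    moreover have "((\<lambda>x. (cos (real 1 * x) - cos (real 3 * x)) / 4) has_integral (0 - 0) / 4) {0..pi}"
      using has_integral_cos_multiple[of 1] has_integral_cos_multiple[of 3]
      by (intro has_integral_divide has_integral_diff) auto
    ultimately have "((\<lambda>x. cos x * (sin x)\<^sup>2) has_integral (0 - 0) / 4) {0..pi}" by (simp only:)
    then show ?thesis using 2 by simp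
  next
    case 3
    have "cos (real k * x) * (sin x)\<^sup>2
        = cos (real k * x) / 2 - (cos (real (k + 2) * x) + cos (real i * x)) / 4" for x
    proof -
      have "real (k + 2) * x = real k * x + 2 * x" "real i * x = real k * x - 2 * x"
        using 3 by (simp_all add: algebra_simps)
      then show ?thesis by (simp only: cos_add cos_diff) (simp add: s2 field_simps)
    qed
    moreover have "((\<lambda>x. cos (real k * x) / 2 - (cos (real (k + 2) * x) + cos (real i * x)) / 4)
        has_integral 0 / 2 - (0 + (if i = 0 then pi else 0)) / 4) {0..pi}"
      using has_integral_cos_multiple[of k] has_integral_cos_multiple[of "k+2"] has_integral_cos_multiple[of i] 3
      by (intro has_integral_divide has_integral_diff has_integral_add) auto
    ultimately show ?thesis using 3 by (simp split: if_splits)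
  qed
qed

section \<open>Fourier coefficients of the kernel\<close>

definition pkern :: "real \<Rightarrow> nat \<Rightarrow> real \<Rightarrow> real" where
  "pkern r k x = cos (real k * x) * (sin x)\<^sup>2 / (1 - 2 * r * cos x + r\<^sup>2)"

text \<open>This is the squared distance between r and e^{ix}. In this form it visibly dominates
  \<open>(sin x)\<^sup>2\<close>.\<close>

lemma pkern_denom: "1 - 2 * r * cos x + r\<^sup>2 = (r - cos x)\<^sup>2 + (sin x)\<^sup>2" for r x :: real
  using sin_cos_squared_add[of x] by (simp add: power2_eq_square algebra_simps)

text \<open>The bound is uniform in \<open>r\<close> and \<open>k\<close> and includes points where
  the denominator vanishes, since division by zero gives 0. It supplies both the boundedness of the
  coefficients and absolute integrability.\<close>

lemma abs_pkern_le: "\<bar>pkern r k x\<bar> \<le> 1"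
proof -
  have d: "(sin x)\<^sup>2 \<le> 1 - 2 * r * cos x + r\<^sup>2" unfolding pkern_denom by simp
  have "\<bar>pkern r k x\<bar> = \<bar>cos (real k * x)\<bar> * ((sin x)\<^sup>2 / (1 - 2 * r * cos x + r\<^sup>2))"
    using d by (simp add: pkern_def abs_mult pkern_denom)
  also have "\<dots> \<le> 1 * 1"
  proof (rule mult_mono)
    have "0 \<le> 1 - 2 * r * cos x + r\<^sup>2" using d zero_le_power2[of "sin x"] by linarith
    then show "(sin x)\<^sup>2 / (1 - 2 * r * cos x + r\<^sup>2) \<le> 1" "0 \<le> (sin x)\<^sup>2 / (1 - 2 * r * cos x + r\<^sup>2)"
      using d by (auto simp: divide_le_eq_1)
  qed auto
  finally show ?thesis by simp
qed

lemma pkern_denom_pos: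
  fixes r x :: real
  assumes "\<bar>r\<bar> < 1"
  shows "1 - 2 * r * cos x + r\<^sup>2 > 0"
proof -
  have "2 * r * cos x \<le> 2 * \<bar>r\<bar>"
    using abs_ge_self[of "r * cos x"] mult_left_mono[OF abs_cos_le_one[of x] abs_ge_zero[of r]]
    by (simp add: abs_mult)
  moreover have "0 < (1 - \<bar>r\<bar>)\<^sup>2" using assms by simp
  ultimately show ?thesis by (simp add: power2_diff)
qed

text \<open>Multiplication by the denominator acts on cosine coefficients as a three-term
  recurrence, because 2 cos x shifts the frequency up and down by one.\<close>

lemma pkern_recurrence:
  assumes "\<bar>r\<bar> < 1"
  shows "(1 + r\<^sup>2) * pkern r (Suc k) x - r * pkern r (Suc (Suc k)) x - r * pkern r k x
      = cos (real (Suc k) * x) * (sin x)\<^sup>2"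
proof -
  let ?D = "1 - 2 * r * cos x + r\<^sup>2"
  have "(1 + r\<^sup>2) * pkern r (Suc k) x - r * pkern r (Suc (Suc k)) x - r * pkern r k x
    = ((1 + r\<^sup>2) * cos (real (Suc k) * x) - r * (cos (real (Suc (Suc k)) * x) + cos (real k * x))) * (sin x)\<^sup>2 / ?D"
    unfolding pkern_def by (simp add: diff_divide_distrib add_divide_distrib algebra_simps)
  also have "\<dots> = cos (real (Suc k) * x) * (sin x)\<^sup>2 * ?D / ?D"
    unfolding cos_Suc_Suc_add by (simp add: algebra_simps)
  also have "\<dots> = cos (real (Suc k) * x) * (sin x)\<^sup>2"
    using pkern_denom_pos[OF assms, of x] by simp
  finally show ?thesis .
qed

text \<open>The homogeneous recurrence has the solutions r^k and r^{-k}. The coefficients are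
  bounded, which excludes the growing one; the few inhomogeneous equations at low index then fix the
  rest.\<close>

lemma has_integral_pkern_less:
  assumes r: "\<bar>r\<bar> < 1"
  shows "(pkern r k has_integral poisson_coeff r k) {0..pi}"
proof -
  define K where "K k = integral {0..pi} (pkern r k)" for k
  have cont: "continuous_on {0..pi} (pkern r k)" for k
    unfolding pkern_def[abs_def] using pkern_denom_pos[OF r]
    by (intro continuous_intros) (simp add: less_imp_neq[symmetric])
  have int: "(pkern r k has_integral K k) {0..pi}" for k
    unfolding K_def using integrable_continuous_real[OF cont] by (rule integrable_integral)
  have rec: "(1 + r\<^sup>2) * K (Suc k) - r * K (Suc (Suc k)) - r * K k = (if k = 1 then - pi / 4 else 0)" for k
  proof -
    have "((\<lambda>x. (1 + r\<^sup>2) * pkern r (Suc k) x - r * pkern r (Suc (Suc k)) x - r * pkern r k x)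
      has_integral (1 + r\<^sup>2) * K (Suc k) - r * K (Suc (Suc k)) - r * K k) {0..pi}"
      by (intro has_integral_diff has_integral_mult_right int)
    then show ?thesis unfolding pkern_recurrence[OF r]
      using has_integral_unique[OF _ has_integral_cos_sin2[of "Suc k"]] by fastforce
  qed
  \<comment> \<open>The equation at frequency 0, where the coefficient at -1 equals the one at 1 by
    evenness of the cosine.\<close>
  have rec0: "(1 + r\<^sup>2) * K 0 - 2 * r * K 1 = pi / 2"
  proof -
    have "((\<lambda>x. (1 + r\<^sup>2) * pkern r 0 x - 2 * r * pkern r 1 x)
      has_integral (1 + r\<^sup>2) * K 0 - 2 * r * K 1) {0..pi}"
      by (intro has_integral_diff has_integral_mult_right int)
    moreover have "(1 + r\<^sup>2) * pkern r 0 x - 2 * r * pkern r 1 x = (sin x)\<^sup>2" for x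
    proof -
      have "(1 + r\<^sup>2) * pkern r 0 x - 2 * r * pkern r 1 x
          = (sin x)\<^sup>2 * (1 - 2 * r * cos x + r\<^sup>2) / (1 - 2 * r * cos x + r\<^sup>2)"
        unfolding pkern_def by (simp add: diff_divide_distrib add_divide_distrib algebra_simps)
      then show ?thesis using pkern_denom_pos[OF r, of x] by simp
    qed
    ultimately show ?thesis
      using has_integral_unique[OF _ has_integral_cos_sin2[of 0]] by fastforce
  qed
  \<comment> \<open>This difference factors the second-order recurrence into two first-order ones:
    \<open>E k = r * E (Suc k)\<close> away from \<open>k = 1\<close>.\<close>
  define E where "E k = K (Suc k) - r * K k" for k
  have E_rec: "E k = r * E (Suc k) + (if k = 1 then - pi / 4 else 0)" for k
    using rec[of k] unfolding E_def by (simp add: algebra_simps power2_eq_square split: if_splits)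
  have K_bound: "\<bar>K k\<bar> \<le> pi" for k
    using has_integral_bound[of 1 "pkern r k" "K k" 0 pi] int[of k] abs_pkern_le by simp
  have E_bound: "\<bar>E k\<bar> \<le> 2 * pi" for k
  proof -
    have "\<bar>r\<bar> * \<bar>K k\<bar> \<le> 1 * pi" using r K_bound[of k] by (intro mult_mono) auto
    then show ?thesis using K_bound[of "Suc k"] unfolding E_def
      using abs_triangle_ineq4[of "K (Suc k)" "r * K k"] by (simp add: abs_mult)
  qed
  have E_pow: "E k = r ^ i * E (k + i)" if "k \<ge> 2" for k i
  proof (induction i)
    case (Suc i)
    then show ?case using E_rec[of "k + i"] that by simp
  qed simp
  \<comment> \<open>Iterating upward writes \<open>E k\<close> as \<open>r ^ i\<close> times a
    bounded quantity for every \<open>i\<close>, so it vanishes.\<close>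
  have E2: "E k = 0" if "k \<ge> 2" for k
  proof -
    have "(\<lambda>i. r ^ i * E (k + i)) \<longlonglongrightarrow> 0"
    proof (rule Lim_null_comparison)
      show "\<forall>\<^sub>F i in sequentially. norm (r ^ i * E (k + i)) \<le> \<bar>r\<bar> ^ i * (2 * pi)"
        using E_bound by (auto simp: abs_mult power_abs intro!: always_eventually mult_left_mono)
      show "(\<lambda>i. \<bar>r\<bar> ^ i * (2 * pi)) \<longlonglongrightarrow> 0"
        using r by (intro tendsto_mult_left_zero LIMSEQ_power_zero) simp
    qed
    then show ?thesis using LIMSEQ_const_iff[of "E k" 0] by (simp flip: E_pow[OF that])
  qed
  have E1: "E 1 = - pi / 4" using E_rec[of 1] E2[of 2] by (simp add: numeral_2_eq_2)
  have E0: "E 0 = - pi * r / 4" using E_rec[of 0] E1 by simp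
  have K1: "K 1 = r * K 0 - pi * r / 4" using E0 by (simp add: E_def)
  \<comment> \<open>Insert the relation between \<open>K 1\<close> and \<open>K 0\<close> into the
    equation at frequency 0.\<close>
  have "(1 - r\<^sup>2) * K 0 = (1 - r\<^sup>2) * (pi / 2)"
    using rec0 unfolding K1 by (simp add: algebra_simps power2_eq_square)
  moreover have "r\<^sup>2 \<noteq> 1" using r by (auto simp: power2_eq_1_iff)
  ultimately have K0: "K 0 = pi / 2" by simp
  have KSS: "K (Suc (Suc k)) = pi / 4 * (r ^ Suc (Suc k) - r ^ k)" for k
  proof (induction k)
    case 0
    have "K 1 = pi * r / 4" using K1 K0 by simp
    moreover have "K (Suc (Suc 0)) = r * K 1 - pi / 4" using E1 by (simp add: E_def)
    ultimately have "K (Suc (Suc 0)) = r * (pi * r / 4) - pi / 4" by (simp only:)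
    then show ?case by (simp add: algebra_simps)
  next
    case (Suc k)
    have "K (Suc (Suc (Suc k))) = r * K (Suc (Suc k))" using E2[of "Suc (Suc k)"] by (simp add: E_def)
    then show ?case unfolding Suc by (simp add: algebra_simps)
  qed
  have "K k = poisson_coeff r k"
    using K0 K1 KSS by (cases "(r, k)" rule: poisson_coeff.cases) auto
  with int show ?thesis by metis
qed

text \<open>For r = 1 or r = -1 the denominator is 2 (1 - r cos x) and sin^2 x = (1 - r cos x)(1 + r
  cos x). The kernel is thus a trigonometric polynomial except possibly at the two endpoints, which
  do not affect the integral.\<close>

lemma has_integral_pkern_unit:
  assumes r: "r\<^sup>2 = 1"
  shows "(pkern r k has_integral poisson_coeff r k) {0..pi}"
proof -
  have int: "((\<lambda>x. cos (real k * x) / 2 + r * (cos x * cos (real k * x)) / 2) has_integral poisson_coeff r k) {0..pi}"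
  proof (cases "(r, k)" rule: poisson_coeff.cases)
    case 1
    have "((\<lambda>x. cos (real 0 * x) / 2 + r * cos (real 1 * x) / 2) has_integral pi / 2 + r * 0 / 2) {0..pi}"
      using has_integral_cos_multiple[of 0] has_integral_cos_multiple[of 1]
      by (intro has_integral_add has_integral_divide has_integral_mult_right) auto
    then show ?thesis using 1 by simp
  next
    case 2
    have "((\<lambda>x. cos (real 1 * x) / 2 + r * (cos (real 0 * x) + cos (real 2 * x)) / 4)
        has_integral 0 / 2 + r * (pi + 0) / 4) {0..pi}"
      using has_integral_cos_multiple[of 0] has_integral_cos_multiple[of 1] has_integral_cos_multiple[of 2]
      by (intro has_integral_add has_integral_divide has_integral_mult_right) auto
    moreover have "r * (cos (real 0 * x) + cos (real 2 * x)) / 4 = r * (cos x * cos (real 1 * x)) / 2" for x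
      using cos_Suc_Suc_add[of 0 x] by (simp add: numeral_2_eq_2)
    ultimately have "((\<lambda>x. cos (real 1 * x) / 2 + r * (cos x * cos (real 1 * x)) / 2)
        has_integral 0 / 2 + r * (pi + 0) / 4) {0..pi}" by (simp only:)
    then show ?thesis using 2 by (simp add: mult.commute)
  next
    case (3 _ i)
    have "((\<lambda>x. cos (real k * x) / 2 + r * (cos (real (Suc k) * x) + cos (real (Suc i) * x)) / 4)
        has_integral 0 / 2 + r * (0 + 0) / 4) {0..pi}"
      using has_integral_cos_multiple[of k] has_integral_cos_multiple[of "Suc k"] has_integral_cos_multiple[of "Suc i"] 3
      by (intro has_integral_add has_integral_divide has_integral_mult_right) auto
    moreover have "r * (cos (real (Suc k) * x) + cos (real (Suc i) * x)) / 4 = r * (cos x * cos (real k * x)) / 2" for x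
      using cos_Suc_Suc_add[of "Suc i" x] 3 by simp
    ultimately have "((\<lambda>x. cos (real k * x) / 2 + r * (cos x * cos (real k * x)) / 2)
        has_integral 0 / 2 + r * (0 + 0) / 4) {0..pi}" by (simp only:)
    moreover have "poisson_coeff r k = 0"
      using 3 r by (simp add: power2_eq_square flip: mult.assoc)
    ultimately show ?thesis by simp
  qed
  have eq: "pkern r k x = cos (real k * x) / 2 + r * (cos x * cos (real k * x)) / 2"
    if "x \<in> {0..pi} - {0, pi}" for x
  proof -
    have "sin x > 0" using that by (intro sin_gt_zero) auto
    then have d: "1 - 2 * r * cos x + r\<^sup>2 > 0" unfolding pkern_denom by (simp add: add_nonneg_pos)
    have "(sin x)\<^sup>2 = 1 - r\<^sup>2 * (cos x)\<^sup>2" using r by (simp add: sin_squared_eq)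
    also have "\<dots> = (1 - r * cos x) * (1 + r * cos x)" by (simp add: algebra_simps power2_eq_square)
    also have "1 - r * cos x = (1 - 2 * r * cos x + r\<^sup>2) / 2" using r by simp
    finally have "(sin x)\<^sup>2 / (1 - 2 * r * cos x + r\<^sup>2) = (1 + r * cos x) / 2"
      using d by simp
    then have "pkern r k x = cos (real k * x) * ((1 + r * cos x) / 2)"
      unfolding pkern_def times_divide_eq_right[symmetric] by (simp only:)
    then show ?thesis by (simp add: field_simps)
  qed
  show ?thesis
    by (rule has_integral_spike_finite[where S = "{0, pi}", OF _ eq int]) simp
qed

text \<open>Absolute integrability is recorded alongside the value since the change of variables for
  the density works with absolutely integrable functions.\<close>

lemma pkern_integral:
  assumes "\<bar>r\<bar> \<le> 1"
  shows "pkern r k absolutely_integrable_on {0..pi}" "integral {0..pi} (pkern r k) = poisson_coeff r k"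
proof -
  have *: "(pkern r k has_integral poisson_coeff r k) {0..pi}"
  proof (cases "\<bar>r\<bar> = 1")
    case True
    then have "r\<^sup>2 = 1" using power2_abs[of r] by simp
    then show ?thesis by (rule has_integral_pkern_unit)
  qed (use assms has_integral_pkern_less in auto)
  then show "integral {0..pi} (pkern r k) = poisson_coeff r k" by (rule integral_unique)
  show "pkern r k absolutely_integrable_on {0..pi}"
    by (rule absolutely_integrable_integrable_bound[of _ _ "\<lambda>_. 1"])
      (use * abs_pkern_le in \<open>auto simp: integrable_on_def\<close>)
qed


text \<open>Writing the denominator as \<open>M (1 - 2 r cos \<theta> + r\<^sup>2)\<close> with \<open>M = max s t\<close>
  reduces to \<open>\<bar>r\<bar> \<le> 1\<close>; the case \<open>r = \<plusminus>1\<close> occurs when a spectral edge touches 0 or 1.\<close>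
lemma pkern_scaled_integral:
  fixes s t :: real and \<sigma> :: real
  assumes s: "s > 0" and t: "t > 0" and \<sigma>: "\<sigma> = 1 \<or> \<sigma> = -1"
  defines "\<rho> \<equiv> sqrt (s * t)"
  defines "g \<equiv> (\<lambda>k x. cos (real k * x) * (sin x)\<^sup>2 / (s + t - 2 * (\<sigma> * \<rho>) * cos x))"
  shows "g k absolutely_integrable_on {0..pi}"
    and "4 * \<rho>\<^sup>2 / pi * (\<sigma> * \<rho>) ^ k * integral {0..pi} (g k)
      = (if k = 0 then 2 * min s t else if k = 1 then (min s t)\<^sup>2
         else min s t ^ k * (min s t - max s t))" (is "_ = ?rhs k")
proof -
  define M where "M = max s t"
  define \<mu> where "\<mu> = min s t"
  define r where "r = \<rho> / M"
  have M: "M > 0" and \<mu>: "\<mu> > 0" "\<mu> \<le> M" using s t by (auto simp: M_def \<mu>_def)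
  have \<rho>2: "\<rho>\<^sup>2 = \<mu> * M" using s t by (auto simp: \<rho>_def M_def \<mu>_def min_def max_def)
  have \<rho>: "\<rho> > 0" using s t by (simp add: \<rho>_def)
  have st: "s + t = \<mu> + M" by (auto simp: M_def \<mu>_def)
  have "\<rho>\<^sup>2 \<le> M\<^sup>2" unfolding \<rho>2 using \<mu> M by (simp add: power2_eq_square)
  then have "\<rho> \<le> M" using M by (simp add: power2_le_iff_abs_le)
  then have r: "0 < r" "r \<le> 1" using M \<rho> by (auto simp: r_def)
  have \<sigma>2: "\<sigma>\<^sup>2 = 1" using \<sigma> by auto
  have \<rho>r: "\<rho> * r = \<mu>" using \<rho>2 M by (simp add: r_def power2_eq_square field_simps)
  have Mr2: "M * r\<^sup>2 = \<mu>" using \<rho>2 M by (simp add: r_def power2_eq_square field_simps)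
  have Mr: "M * r = \<rho>" using M by (simp add: r_def)
  have "s + t - 2 * (\<sigma> * \<rho>) * cos x = M * (1 - 2 * (\<sigma> * r) * cos x + (\<sigma> * r)\<^sup>2)" for x
    using \<sigma>2 Mr2 Mr unfolding st power_mult_distrib by (simp add: algebra_simps)
  then have g: "g k = (\<lambda>x. 1 / M * pkern (\<sigma> * r) k x)"
    unfolding g_def pkern_def by (simp add: fun_eq_iff)
  have "\<bar>\<sigma> * r\<bar> \<le> 1" using \<sigma> r by auto
  note pk = pkern_integral[OF this, of k]
  show "g k absolutely_integrable_on {0..pi}"
    unfolding g using pk(1) by (intro set_integrable_mult_right)
  have "integral {0..pi} (g k) = poisson_coeff (\<sigma> * r) k / M"
    unfolding g using pk(2) by simp
  then have "4 * \<rho>\<^sup>2 / pi * (\<sigma> * \<rho>) ^ k * integral {0..pi} (g k)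
      = 4 * \<mu> / pi * ((\<sigma> * \<rho>) ^ k * poisson_coeff (\<sigma> * r) k)"
    using M unfolding \<rho>2 by simp
  also have "\<dots> = ?rhs k"
  proof (cases "(\<sigma> * r, k)" rule: poisson_coeff.cases)
    case 1
    then show ?thesis by (simp add: \<mu>_def)
  next
    case 2
    have "(\<sigma> * \<rho>) * (\<sigma> * r) = \<mu>"
      using \<sigma>2 \<rho>r by (metis mult.assoc mult.left_commute mult_1 power2_eq_square)
    then have "4 * \<mu> / pi * ((\<sigma> * \<rho>) * (pi * (\<sigma> * r) / 4)) = \<mu>\<^sup>2"
      by (simp add: power2_eq_square field_simps)
    then show ?thesis using 2 by (simp add: \<mu>_def)
  next
    case (3 _ i)
    then have k: "k = Suc (Suc i)" by simp
    \<comment> \<open>The sign \<sigma> occurs with exponent 2 k in one term and k + i = 2 i + 2 in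
      the other, so it drops out.\<close>
    have "(\<sigma> * \<rho>) ^ k * ((\<sigma> * r) ^ Suc (Suc i) - (\<sigma> * r) ^ i) = \<sigma> ^ k * (\<sigma> ^ k * (\<rho> * r) ^ k - \<sigma> ^ i * \<rho>\<^sup>2 * (\<rho> * r) ^ i)"
      using k by (simp add: power_mult_distrib algebra_simps power2_eq_square)
    also have "\<sigma> ^ k = \<sigma> ^ i" using k \<sigma>2 by (simp add: power2_eq_square flip: mult.assoc)
    also have "\<sigma> ^ i * (\<sigma> ^ i * (\<rho> * r) ^ k - \<sigma> ^ i * \<rho>\<^sup>2 * (\<rho> * r) ^ i) = (\<sigma> ^ i)\<^sup>2 * ((\<rho> * r) ^ k - \<rho>\<^sup>2 * (\<rho> * r) ^ i)"
      by (simp add: power2_eq_square algebra_simps)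
    also have "(\<sigma> ^ i)\<^sup>2 = 1" using \<sigma>2 by (metis power_mult mult.commute power_one)
    also have "1 * ((\<rho> * r) ^ k - \<rho>\<^sup>2 * (\<rho> * r) ^ i) = \<mu> ^ Suc i * (\<mu> - M)"
      unfolding \<rho>2 \<rho>r using k by (simp add: algebra_simps)
    finally have *: "(\<sigma> * \<rho>) ^ k * ((\<sigma> * r) ^ Suc (Suc i) - (\<sigma> * r) ^ i) = \<mu> ^ Suc i * (\<mu> - M)" .
    have "4 * \<mu> / pi * ((\<sigma> * \<rho>) ^ k * poisson_coeff (\<sigma> * r) k)
        = \<mu> * ((\<sigma> * \<rho>) ^ k * ((\<sigma> * r) ^ Suc (Suc i) - (\<sigma> * r) ^ i))"
      using k by simp
    also have "\<dots> = \<mu> * (\<mu> ^ Suc i * (\<mu> - M))" by (simp only: *)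
    finally show ?thesis using k by (simp add: M_def \<mu>_def mult.assoc)
  qed
  finally show "4 * \<rho>\<^sup>2 / pi * (\<sigma> * \<rho>) ^ k * integral {0..pi} (g k) = ?rhs k" .
qed


text \<open>Here the two roots behind \<open>cheb\<close> are -\<rho> e^{ix} and -\<rho> e^{-ix}.
  The minus sign makes the substitution increasing on [0, pi].\<close>

lemma cheb_cos: "cheb m (\<rho>\<^sup>2) k (m - 2 * \<rho> * cos x) = 2 * (- \<rho>) ^ k * cos (real k * x)"
proof (induction k rule: induct_nat_012)
  case (ge2 k)
  have "cheb m (\<rho>\<^sup>2) (Suc (Suc k)) (m - 2 * \<rho> * cos x)
      = 2 * (- \<rho>) ^ Suc (Suc k) * (2 * cos x * cos (real (Suc k) * x) - cos (real k * x))"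
    unfolding cheb.simps ge2 by (simp add: algebra_simps power2_eq_square)
  then show ?case unfolding cos_Suc_Suc_add[symmetric] by simp
qed auto

text \<open>Meant for the atoms 0 and 1, where the two roots are explicit products of the
  parameters.\<close>

lemma cheb_roots:
  assumes "m = x - (y + z)" "q = y * z"
  shows "cheb m q k x = y ^ k + z ^ k"
proof (induction k rule: induct_nat_012)
  case (ge2 k)
  then show ?case unfolding cheb.simps ge2 assms by (simp add: algebra_simps)
qed (use assms in auto)

section \<open>Density and atoms of the MANOVA law\<close>

locale manova_params =
  fixes \<alpha> \<beta> :: real
  assumes \<alpha>: "0 < \<alpha>" "\<alpha> < 1" and \<beta>: "0 < \<beta>" "\<beta> < 1"
begin

definition m where "m = \<alpha> + \<beta> - 2 * \<alpha> * \<beta>"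
definition q where "q = \<alpha> * (1 - \<alpha>) * \<beta> * (1 - \<beta>)"
definition \<rho> where "\<rho> = sqrt q"

abbreviation "rm \<equiv> manova_rminus \<alpha> \<beta>"
abbreviation "rp \<equiv> manova_rplus \<alpha> \<beta>"

lemma q_pos: "q > 0" using \<alpha> \<beta> by (simp add: q_def)
lemma \<rho>_pos: "\<rho> > 0" and \<rho>2: "\<rho>\<^sup>2 = q" using q_pos by (simp_all add: \<rho>_def)

lemma rm_eq: "rm = m - 2 * \<rho>" and rp_eq: "rp = m + 2 * \<rho>"
proof -
  have "sqrt (\<alpha> * (1 - \<beta>)) * sqrt (\<beta> * (1 - \<alpha>)) = \<rho>"
    by (simp add: \<rho>_def q_def real_sqrt_mult[symmetric] mult_ac)
  then show "rm = m - 2 * \<rho>" "rp = m + 2 * \<rho>"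
    using \<alpha> \<beta> by (simp_all add: manova_rminus_def manova_rplus_def power2_diff power2_sum m_def algebra_simps)
qed

lemma rm_nonneg: "0 \<le> rm"
  by (simp add: manova_rminus_def)

text \<open>The gap 1 - r_+ is the square of \<open>sqrt (\<alpha> * \<beta>) - sqrt ((1 - \<alpha>)
  * (1 - \<beta>))\<close>.\<close>

lemma rp_le_1: "rp \<le> 1"
proof -
  have "0 \<le> (sqrt (\<alpha> * \<beta>) - sqrt ((1 - \<alpha>) * (1 - \<beta>)))\<^sup>2" by simp
  also have "\<dots> = \<alpha> * \<beta> + (1 - \<alpha>) * (1 - \<beta>) - 2 * \<rho>"
    using \<alpha> \<beta> by (simp add: power2_diff \<rho>_def q_def real_sqrt_mult[symmetric] mult_ac)
  finally show ?thesis by (simp add: rp_eq m_def algebra_simps)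
qed

text \<open>The square root in the density and the Jacobian each give 2 \<rho> sin x, and 1 / (y (1
  - y)) = 1 / y + 1 / (1 - y) splits the integrand into two kernels. At the endpoints both sides are
  0.\<close>

lemma manova_cheb_substitution:
  fixes k x
  assumes x: "x \<in> {0..pi}"
  shows "\<bar>2 * \<rho> * sin x\<bar> * (manova_density \<alpha> \<beta> (m - 2 * \<rho> * cos x) * cheb m q k (m - 2 * \<rho> * cos x))
    = 4 * \<rho>\<^sup>2 / pi * (- \<rho>) ^ k * (cos (real k * x) * (sin x)\<^sup>2 / (m - 2 * \<rho> * cos x)
        + cos (real k * x) * (sin x)\<^sup>2 / (1 - m + 2 * \<rho> * cos x))"
proof (cases "sin x = 0")
  case False
  then have sin: "sin x > 0" using sin_ge_zero x by (metis atLeastAtMost_iff order_le_less)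
  have "(cos x)\<^sup>2 < 1" using sin by (simp add: cos_squared_eq)
  then have "cos x < 1" "cos x > -1" by (auto simp: abs_square_less_1)
  then have "\<rho> * cos x < \<rho> * 1" "\<rho> * (- 1) < \<rho> * cos x"
    using \<rho>_pos mult_strict_left_mono[of "cos x" 1 \<rho>] mult_strict_left_mono[of "-1" "cos x" \<rho>] by simp_all
  then have x01: "0 < m - 2 * \<rho> * cos x" "m - 2 * \<rho> * cos x < 1"
    using rm_nonneg rp_le_1 rm_eq rp_eq by auto
  have "(rp - (m - 2 * \<rho> * cos x)) * ((m - 2 * \<rho> * cos x) - rm) = (2 * \<rho>)\<^sup>2 * (1 - (cos x)\<^sup>2)"
    by (simp add: rm_eq rp_eq algebra_simps power2_eq_square)
  also have "\<dots> = (2 * \<rho> * sin x)\<^sup>2" by (simp add: sin_squared_eq power_mult_distrib)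
  finally have "manova_density \<alpha> \<beta> (m - 2 * \<rho> * cos x)
     = 2 * \<rho> * sin x / (2 * pi * (m - 2 * \<rho> * cos x) * (1 - (m - 2 * \<rho> * cos x)))"
    unfolding manova_density_def using sin \<rho>_pos by (simp add: real_sqrt_unique)
  moreover have "\<bar>2 * \<rho> * sin x\<bar> = 2 * \<rho> * sin x" using sin \<rho>_pos by simp
  moreover have "2 * \<rho> * sin x * (2 * \<rho> * sin x / (2 * pi * y * (1 - y)) * (2 * (- \<rho>) ^ k * c))
    = 4 * \<rho>\<^sup>2 / pi * (- \<rho>) ^ k * (c * (sin x)\<^sup>2 / y + c * (sin x)\<^sup>2 / (1 - y))" if "0 < y" "y < 1" for y c
    using that by (simp add: divide_simps) (simp add: algebra_simps power2_eq_square)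
  ultimately show ?thesis
    using x01 unfolding \<rho>2[symmetric] cheb_cos by simp
qed simp

text \<open>Both denominators have the shape required by \<open>pkern_scaled_integral\<close>: m = s
  + t and 1 - m = s' + t', while s t = s' t' = \<rho>^2. The signs are \<sigma> = 1 for the pole at
  0 and \<sigma> = -1 for the pole at 1.\<close>

lemma manova_cheb_lebesgue:
  shows "(\<lambda>x. manova_density \<alpha> \<beta> x * cheb m q k x) absolutely_integrable_on {rm..rp}" (is ?A)
    and "integral {rm..rp} (\<lambda>x. manova_density \<alpha> \<beta> x * cheb m q k x) =
      (let s = \<alpha> * (1 - \<beta>); t = \<beta> * (1 - \<alpha>); s' = \<alpha> * \<beta>; t' = (1 - \<alpha>) * (1 - \<beta>) in
       if k = 0 then 2 * min s t + 2 * min s' t'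
       else if k = 1 then (min s' t')\<^sup>2 - (min s t)\<^sup>2
       else (- min s t) ^ k * (min s t - max s t) + min s' t' ^ k * (min s' t' - max s' t'))" (is ?B)
proof -
  define s t s' t' where "s = \<alpha> * (1 - \<beta>)" "t = \<beta> * (1 - \<alpha>)" "s' = \<alpha> * \<beta>" "t' = (1 - \<alpha>) * (1 - \<beta>)"
  note st = this
  have pos: "s > 0" "t > 0" "s' > 0" "t' > 0" using \<alpha> \<beta> by (auto simp: st)
  have \<rho>: "sqrt (s * t) = \<rho>" "sqrt (s' * t') = \<rho>"
    by (simp_all add: \<rho>_def q_def st mult_ac)
  define g where "g = (\<lambda>x. m - 2 * \<rho> * cos x)"
  define f where "f = (\<lambda>x. manova_density \<alpha> \<beta> x * cheb m q k x)"
  define g1 where "g1 = (\<lambda>x. cos (real k * x) * (sin x)\<^sup>2 / (s + t - 2 * (1 * \<rho>) * cos x))"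
  define g2 where "g2 = (\<lambda>x. cos (real k * x) * (sin x)\<^sup>2 / (s' + t' - 2 * (- 1 * \<rho>) * cos x))"
  note i1 = pkern_scaled_integral[OF pos(1,2), of 1 k, unfolded \<rho>, folded g1_def]
  note i2 = pkern_scaled_integral[OF pos(3,4), of "-1" k, unfolded \<rho>, folded g2_def]
  have eq: "\<bar>2 * \<rho> * sin x\<bar> * f (g x) = 4 * \<rho>\<^sup>2 / pi * (- \<rho>) ^ k * (g1 x + g2 x)" if "x \<in> {0..pi}" for x
  proof -
    have "m = s + t" "1 - m = s' + t'" by (simp_all add: m_def st algebra_simps)
    then show ?thesis
      using manova_cheb_substitution[OF that, of k] unfolding f_def g_def g1_def g2_def by simp
  qed
  have sum_ai: "(\<lambda>x. 4 * \<rho>\<^sup>2 / pi * (- \<rho>) ^ k * (g1 x + g2 x)) absolutely_integrable_on {0..pi}"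
    by (intro set_integrable_mult_right set_integral_add i1(1) i2(1)) auto
  then have ai: "(\<lambda>x. \<bar>2 * \<rho> * sin x\<bar> * f (g x)) absolutely_integrable_on {0..pi}"
    by (subst set_integrable_cong[OF refl refl eq]) auto
  have int: "integral {0..pi} (\<lambda>x. \<bar>2 * \<rho> * sin x\<bar> * f (g x))
      = (-1) ^ k * (4 * \<rho>\<^sup>2 / pi * (1 * \<rho>) ^ k * integral {0..pi} g1) + 4 * \<rho>\<^sup>2 / pi * (- 1 * \<rho>) ^ k * integral {0..pi} g2"
  proof -
    have "integral {0..pi} (\<lambda>x. \<bar>2 * \<rho> * sin x\<bar> * f (g x))
      = integral {0..pi} (\<lambda>x. 4 * \<rho>\<^sup>2 / pi * (- \<rho>) ^ k * (g1 x + g2 x))"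
      by (rule integral_cong) (rule eq)
    also have "\<dots> = 4 * \<rho>\<^sup>2 / pi * (- \<rho>) ^ k * (integral {0..pi} g1 + integral {0..pi} g2)"
      using i1(1) i2(1) by (simp add: integral_add set_lebesgue_integral_eq_integral(1))
    also have "(- \<rho>) ^ k = (- 1) ^ k * \<rho> ^ k" by (rule power_minus)
    finally show ?thesis by (simp add: power_minus[of \<rho>] algebra_simps add_divide_distrib)
  qed
  have inj: "inj_on g {0..pi}"
    using \<rho>_pos by (auto simp: inj_on_def g_def cos_inj_pi)
  have img: "g ` {0..pi} = {rm..rp}"
  proof
    show "g ` {0..pi} \<subseteq> {rm..rp}"
    proof (rule image_subsetI)
      fix x
      have "\<rho> * cos x \<le> \<rho> * 1" "\<rho> * (- 1) \<le> \<rho> * cos x"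
        using \<rho>_pos mult_left_mono[of "cos x" 1 \<rho>] mult_left_mono[of "-1" "cos x" \<rho>] by simp_all
      then show "g x \<in> {rm..rp}" unfolding atLeastAtMost_iff g_def rm_eq rp_eq by linarith
    qed
    show "{rm..rp} \<subseteq> g ` {0..pi}"
    proof
      fix y assume y: "y \<in> {rm..rp}"
      have "\<bar>(m - y) / (2 * \<rho>)\<bar> \<le> 1" using y \<rho>_pos by (auto simp: rm_eq rp_eq abs_le_iff field_simps)
      then have "-1 \<le> (m - y) / (2 * \<rho>)" "(m - y) / (2 * \<rho>) \<le> 1" by linarith+
      then have "cos (arccos ((m - y) / (2 * \<rho>))) = (m - y) / (2 * \<rho>)" "arccos ((m - y) / (2 * \<rho>)) \<in> {0..pi}"
        using arccos_lbound arccos_ubound by auto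
      then show "y \<in> g ` {0..pi}" using \<rho>_pos unfolding g_def by (intro image_eqI) auto
    qed
  qed
  have "f absolutely_integrable_on (g ` {0..pi}) \<and> integral (g ` {0..pi}) f
     = integral {0..pi} (\<lambda>x. \<bar>2 * \<rho> * sin x\<bar> * f (g x))"
    using ai by (subst has_absolute_integral_change_of_variables_1'[symmetric, OF _ _ inj])
      (auto simp: g_def intro!: derivative_eq_intros)
  moreover have "4 * \<rho>\<^sup>2 / pi * (1 * \<rho>) ^ k * integral {0..pi} g1 = (if k = 0 then 2 * min s t
      else if k = 1 then (min s t)\<^sup>2 else min s t ^ k * (min s t - max s t))"
    by (rule i1(2)) simp
  moreover have "4 * \<rho>\<^sup>2 / pi * (- 1 * \<rho>) ^ k * integral {0..pi} g2 = (if k = 0 then 2 * min s' t'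
      else if k = 1 then (min s' t')\<^sup>2 else min s' t' ^ k * (min s' t' - max s' t'))"
    by (rule i2(2)) simp
  ultimately have "f absolutely_integrable_on {rm..rp} \<and> integral {rm..rp} f
     = (-1) ^ k * (if k = 0 then 2 * min s t
      else if k = 1 then (min s t)\<^sup>2 else min s t ^ k * (min s t - max s t)) + (if k = 0 then 2 * min s' t'
      else if k = 1 then (min s' t')\<^sup>2 else min s' t' ^ k * (min s' t' - max s' t'))"
    unfolding img int by (simp only:)
  then show ?A ?B
    by (auto simp: f_def st[symmetric] Let_def power_minus[of "min s t"])
qed

lemma density_measurable[measurable]: "manova_density \<alpha> \<beta> \<in> borel_measurable borel"
  unfolding manova_density_def[abs_def] by measurable

lemma density_nonneg:
  assumes "x \<in> {rm..rp}"
  shows "0 \<le> manova_density \<alpha> \<beta> x"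
  using assms rm_nonneg rp_le_1 by (auto simp: manova_density_def intro!: divide_nonneg_nonneg mult_nonneg_nonneg)

lemma density_integrable: "set_integrable lborel {rm..rp} (manova_density \<alpha> \<beta>)"
proof -
  \<comment> \<open>The factor 1/2 undoes the normalisation \<open>cheb m q 0 x = 2\<close>.\<close>
  have "set_integrable lebesgue {rm..rp} (\<lambda>x. 1 / 2 * (manova_density \<alpha> \<beta> x * cheb m q 0 x))"
    by (intro set_integrable_mult_right manova_cheb_lebesgue)
  then have "integrable lebesgue (\<lambda>x. indicator {rm..rp} x *\<^sub>R manova_density \<alpha> \<beta> x)"
    by (simp add: set_integrable_def)
  then show ?thesis unfolding set_integrable_def by (subst (asm) integrable_completion) auto
qed

text \<open>The density itself can be unbounded, at 0 if \<alpha> = \<beta> and at 1 if \<alpha> +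
  \<beta> = 1. The dominating function is therefore a multiple of the density, using that
  \<open>f\<close> is bounded on the support.\<close>

lemma density_mult_integrable:
  assumes f: "continuous_on UNIV f"
  shows "set_integrable lborel {rm..rp} (\<lambda>x. manova_density \<alpha> \<beta> x * f x)"
proof -
  have [measurable]: "f \<in> borel_measurable borel" using f by (rule borel_measurable_continuous_onI)
  have "compact (f ` {rm..rp})" using f by (intro compact_continuous_image continuous_on_subset[OF f]) auto
  then have "bounded (f ` {rm..rp})" by (rule compact_imp_bounded)
  then obtain C where "\<forall>y\<in>f ` {rm..rp}. norm y \<le> C" unfolding bounded_iff ..
  then have C: "norm (f x) \<le> C" if "x \<in> {rm..rp}" for x using that by blast
  have "set_integrable lborel {rm..rp} (\<lambda>x. C * manova_density \<alpha> \<beta> x)"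
    by (intro set_integrable_mult_right density_integrable)
  then show ?thesis
  proof (rule set_integrable_bound)
    show "set_borel_measurable lborel {rm..rp} (\<lambda>x. manova_density \<alpha> \<beta> x * f x)"
      unfolding set_borel_measurable_def by measurable
    have "norm (manova_density \<alpha> \<beta> x * f x) \<le> norm (C * manova_density \<alpha> \<beta> x)" if "x \<in> {rm..rp}" for x
      using C[OF that] density_nonneg[OF that] by (auto simp: abs_mult mult.commute intro!: mult_right_mono)
    then show "AE x in lborel. x \<in> {rm..rp} \<longrightarrow> norm (manova_density \<alpha> \<beta> x * f x) \<le> norm (C * manova_density \<alpha> \<beta> x)"
      by auto
  qed
qed

lemma manova_integral_add:
  assumes "continuous_on UNIV f" "continuous_on UNIV g"
  shows "manova_integral \<alpha> \<beta> (\<lambda>x. f x + g x) = manova_integral \<alpha> \<beta> f + manova_integral \<alpha> \<beta> g"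
  using set_integral_add(2)[OF density_mult_integrable[OF assms(1)] density_mult_integrable[OF assms(2)]]
  by (simp add: manova_integral_def algebra_simps)

lemma manova_integral_cmult:
  "manova_integral \<alpha> \<beta> (\<lambda>x. c * f x) = c * manova_integral \<alpha> \<beta> f"
proof -
  have "(LBINT x:{rm..rp}. manova_density \<alpha> \<beta> x * (c * f x)) = c * (LBINT x:{rm..rp}. manova_density \<alpha> \<beta> x * f x)"
    by (subst set_integral_mult_right[symmetric]) (simp add: mult.left_commute)
  then show ?thesis by (simp add: manova_integral_def algebra_simps)
qed

lemma continuous_on_cheb: "continuous_on UNIV (cheb m q k)"
proof (induction k rule: induct_nat_012)
  case 0
  have "cheb m q 0 = (\<lambda>x. 2)" by auto
  then show ?case by simp
next
  case 1
  have "cheb m q (Suc 0) = (\<lambda>x. x - m)" by auto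
  then show ?case by (auto intro!: continuous_intros)
next
  case (ge2 k)
  have "cheb m q (Suc (Suc k)) = (\<lambda>x. (x - m) * cheb m q (Suc k) x - q * cheb m q k x)" by auto
  then show ?case using ge2 by (auto intro!: continuous_intros)
qed

text \<open>For k > 0 this is what \<open>trace_mixed_pow\<close> yields when the mixed trace
  vanishes and the normalised traces are \<alpha> and \<beta>. The case k = 0 stands apart because
  there the mixed trace is 1; it says that the total mass is 1.\<close>

lemma manova_integral_cheb_eq:
  "manova_integral \<alpha> \<beta> (cheb m q k) =
     (if k = 0 then 2 else (1 - \<alpha>) * (- (1 - \<alpha>) * \<beta>) ^ k + (1 - \<beta>) * (- \<alpha> * (1 - \<beta>)) ^ k
        - (1 - \<alpha> - \<beta>) * (\<alpha> * \<beta>) ^ k)"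
proof -
  define s t s' t' where "s = \<alpha> * (1 - \<beta>)" "t = \<beta> * (1 - \<alpha>)" "s' = \<alpha> * \<beta>" "t' = (1 - \<alpha>) * (1 - \<beta>)"
  note st = this
  have 0: "cheb m q k 0 = (- s) ^ k + (- t) ^ k"
    by (rule cheb_roots) (simp_all add: m_def q_def st algebra_simps)
  have 1: "cheb m q k 1 = s' ^ k + t' ^ k"
    by (rule cheb_roots) (simp_all add: m_def q_def st algebra_simps)
  have I: "(LBINT x:{rm..rp}. manova_density \<alpha> \<beta> x * cheb m q k x) =
      (if k = 0 then 2 * min s t + 2 * min s' t'
       else if k = 1 then (min s' t')\<^sup>2 - (min s t)\<^sup>2
       else (- min s t) ^ k * (min s t - max s t) + min s' t' ^ k * (min s' t' - max s' t'))"
    using set_borel_integral_eq_integral(2)[OF density_mult_integrable[OF continuous_on_cheb[of k]]]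
      manova_cheb_lebesgue(2)[of k] by (simp add: st Let_def)
  \<comment> \<open>The atom weights in terms of the four products: \<open>max s t\<close> and
    \<open>min s' t'\<close> are what removes the case distinction left by the density.\<close>
  have w0: "1 - min \<alpha> \<beta> = max s t + t'" and w1: "max (\<alpha> + \<beta> - 1) 0 = s' - min s' t'"
    by (auto simp: st min_def max_def algebra_simps)
  have sums: "1 - \<alpha> = t + t'" "1 - \<beta> = s + t'" "1 - \<alpha> - \<beta> = t' - s'" "1 = s + t + s' + t'"
    by (simp_all add: st algebra_simps)
  \<comment> \<open>Both products are the constant \<open>q\<close> of the locale; for
    \<open>k = 1\<close> this cancels the cross terms of the two atoms.\<close>
  have q: "s * t = s' * t'" by (simp add: st)
  have roots: "- (1 - \<alpha>) * \<beta> = - t" "- \<alpha> * (1 - \<beta>) = - s" "\<alpha> * \<beta> = s'" by (simp_all add: st algebra_simps)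
  have eq: "manova_integral \<alpha> \<beta> (cheb m q k) =
      (if k = 0 then 2 * min s t + 2 * min s' t'
       else if k = 1 then (min s' t')\<^sup>2 - (min s t)\<^sup>2
       else (- min s t) ^ k * (min s t - max s t) + min s' t' ^ k * (min s' t' - max s' t'))
      + (max s t + t') * ((- s) ^ k + (- t) ^ k) + (s' - min s' t') * (s' ^ k + t' ^ k)"
    unfolding manova_integral_def I 0 1 w0 w1 ..
  consider "k = 0" | "k = 1" | "k \<ge> 2" by linarith
  then show ?thesis
  proof cases
    case 1
    then show ?thesis unfolding eq using sums(4) by (auto simp: min_def max_def)
  next
    case 2
    then show ?thesis unfolding eq roots unfolding sums(3) unfolding sums(1,2) using q
      by (auto simp: min_def max_def power2_eq_square algebra_simps)
  next
    case 3
    then show ?thesis unfolding eq roots unfolding sums(3) unfolding sums(1,2)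
      by (cases "s \<le> t"; cases "s' \<le> t'") (simp_all add: min_def max_def algebra_simps)
  qed
qed

text \<open>The functional is integration against a positive measure of mass 1 carried by
  [0, 1].\<close>

lemma manova_integral_bound:
  assumes f: "continuous_on UNIV f" and le: "\<And>x. x \<in> {0..1} \<Longrightarrow> \<bar>f x\<bar> \<le> \<delta>"
  shows "\<bar>manova_integral \<alpha> \<beta> f\<bar> \<le> \<delta>"
proof -
  have one: "manova_integral \<alpha> \<beta> (\<lambda>x. 1) = 1"
    using manova_integral_cheb_eq[of 0] manova_integral_cmult[of "1/2" "cheb m q 0"] by simp
  have mono: "(LBINT x:{rm..rp}. manova_density \<alpha> \<beta> x * g x) \<le> \<delta> * (LBINT x:{rm..rp}. manova_density \<alpha> \<beta> x)"
    if g: "continuous_on UNIV g" "\<And>x. x \<in> {0..1} \<Longrightarrow> g x \<le> \<delta>" for g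
  proof -
    have "(LBINT x:{rm..rp}. manova_density \<alpha> \<beta> x * g x) \<le> (LBINT x:{rm..rp}. \<delta> * manova_density \<alpha> \<beta> x)"
    proof (rule set_integral_mono)
      fix x assume "x \<in> {rm..rp}"
      then show "manova_density \<alpha> \<beta> x * g x \<le> \<delta> * manova_density \<alpha> \<beta> x"
        using density_nonneg[of x] g(2)[of x] rm_nonneg rp_le_1
        by (simp add: mult.commute[of _ "g x"] mult_right_mono)
    qed (intro density_mult_integrable g set_integrable_mult_right density_integrable)+
    then show ?thesis by simp
  qed
  have upper: "manova_integral \<alpha> \<beta> g \<le> \<delta>"
    if g: "continuous_on UNIV g" "\<And>x. x \<in> {0..1} \<Longrightarrow> g x \<le> \<delta>" for g
  proof -
    have "manova_integral \<alpha> \<beta> g \<le> \<delta> * (LBINT x:{rm..rp}. manova_density \<alpha> \<beta> x)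
        + (1 - min \<alpha> \<beta>) * \<delta> + max (\<alpha> + \<beta> - 1) 0 * \<delta>"
      unfolding manova_integral_def using \<alpha> \<beta>
      by (intro add_mono mono mult_left_mono g) auto
    also have "\<dots> = \<delta> * manova_integral \<alpha> \<beta> (\<lambda>x. 1)"
      by (simp add: manova_integral_def algebra_simps)
    finally show ?thesis using one by simp
  qed
  have "manova_integral \<alpha> \<beta> f \<le> \<delta>" using f le by (intro upper) (auto simp: abs_le_iff)
  moreover have "- manova_integral \<alpha> \<beta> f \<le> \<delta>"
    using upper[of "\<lambda>x. - 1 * f x"] f le unfolding manova_integral_cmult
    by (auto simp: abs_le_iff intro!: continuous_intros)
  ultimately show ?thesis by linarith
qed

end

section \<open>Deviation of the spectral Chebyshev moments from their limits\<close>

lemma esd_integral_add: "esd_integral H (\<lambda>x. f x + g x) = esd_integral H f + esd_integral H g"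
  by (simp add: esd_integral_def sum.distrib algebra_simps add_divide_distrib)

lemma esd_integral_cmult: "esd_integral H (\<lambda>x. c * f x) = c * esd_integral H f"
  by (simp add: esd_integral_def sum_distrib_left mult.left_commute)

lemma esd_integral_bound:
  assumes A: "orth_proj_mat n A" and B: "orth_proj_mat n B" and le: "\<And>x. x \<in> {0..1} \<Longrightarrow> \<bar>f x\<bar> \<le> \<delta>"
  shows "\<bar>esd_integral (A * B * A) f\<bar> \<le> \<delta>"
proof -
  obtain xs where xs: "length xs = n" "set xs \<subseteq> {0..1}" "esd_integral (A * B * A) f = (\<Sum>x\<leftarrow>xs. f x) / real n"
    using proj_product_spectrum[OF A B] by metis
  have "0 \<le> \<delta>" using le[of 0] by auto
  have "\<bar>\<Sum>x\<leftarrow>xs. f x\<bar> \<le> (\<Sum>x\<leftarrow>xs. \<bar>f x\<bar>)"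
    using sum_list_abs[of "map f xs"] by (simp add: comp_def)
  also have "\<dots> \<le> (\<Sum>x\<leftarrow>xs. \<delta>)"
    using xs(2) by (intro sum_list_mono le) auto
  finally have "\<bar>\<Sum>x\<leftarrow>xs. f x\<bar> \<le> real n * \<delta>" using xs(1) by (simp add: sum_list_triv)
  then show ?thesis unfolding xs(3) using \<open>0 \<le> \<delta>\<close>
    by (cases "n = 0") (simp_all add: divide_le_eq mult.commute)
qed

lemma esd_integral_power:
  assumes A: "orth_proj_mat n A" and B: "orth_proj_mat n B"
  shows "esd_integral (A * B * A) (\<lambda>x. x ^ j) = Re (mat_trace ((A * B * A) ^\<^sub>m j)) / real n"
  by (rule proj_product_spectrum[OF A B]) simp

lemma orth_proj_one: "orth_proj_mat n (1\<^sub>m n)"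
proof -
  have "mat_adjoint (1\<^sub>m n) = (1\<^sub>m n :: complex mat)"
    by (rule eq_matI) (auto simp: mat_adjoint_def mat_of_rows_def conjugate_complex_def)
  then show ?thesis by (simp add: orth_proj_mat_def)
qed

lemma norm_trace_orth_proj:
  assumes A: "orth_proj_mat n A"
  shows "cmod (mat_trace A) \<le> real n"
proof -
  note AD = orth_proj_matD[OF A]
  \<comment> \<open>With the identity in place of the second projection,
    \<open>A * 1\<^sub>m n * A\<close> is \<open>A\<close> itself.\<close>
  obtain xs where xs: "length xs = n" "set xs \<subseteq> {0..1}"
    "\<And>j. mat_trace ((A * 1\<^sub>m n * A) ^\<^sub>m j) = of_real (\<Sum>x\<leftarrow>xs. x ^ j)"
    using proj_product_spectrum[OF A orth_proj_one] by metis
  have eq: "mat_trace A = of_real (\<Sum>x\<leftarrow>xs. x)"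
    using xs(3)[of 1] AD by (simp add: right_mult_one_mat[of _ n n] left_mult_one_mat[of _ n n])
  have "\<bar>\<Sum>x\<leftarrow>xs. x\<bar> \<le> (\<Sum>x\<leftarrow>xs. \<bar>x\<bar>)" using sum_list_abs[of xs] by simp
  also have "\<dots> \<le> (\<Sum>x\<leftarrow>xs. 1)" using xs(2) by (intro sum_list_mono) auto
  finally show ?thesis unfolding eq norm_of_real using xs(1) by (simp add: sum_list_triv)
qed

context manova_params
begin

text \<open>The case \<open>j = 0\<close> of \<open>mixed_trace_eq\<close>, divided by the
  dimension.\<close>

lemma trace_mixed_pow:
  fixes k :: nat
  assumes A: "orth_proj_mat n A" and B: "orth_proj_mat n B" and n: "n > 0"
  defines "W \<equiv> mat_trace (((A - of_real \<alpha> \<cdot>\<^sub>m 1\<^sub>m n) * (B - of_real \<beta> \<cdot>\<^sub>m 1\<^sub>m n)) ^\<^sub>m k) / of_nat n"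
    and "tA \<equiv> mat_trace A / of_nat n" and "tB \<equiv> mat_trace B / of_nat n"
  shows "W = of_real (esd_integral (A * B * A) (cheb m q k)) + (1 - tA - tB) * of_real ((\<alpha> * \<beta>) ^ k)
     + (tA - 1) * of_real ((- (1 - \<alpha>) * \<beta>) ^ k) + (tB - 1) * of_real ((- \<alpha> * (1 - \<beta>)) ^ k)"
proof -
  note AD = orth_proj_matD[OF A] and BD = orth_proj_matD[OF B]
  interpret P: two_projections n A B by unfold_locales (use AD BD in auto)
  obtain xs where xs: "\<And>f. esd_integral (A * B * A) f = (\<Sum>x\<leftarrow>xs. f x) / real n"
    "\<And>j. mat_trace ((A * B * A) ^\<^sub>m j) = of_real (\<Sum>x\<leftarrow>xs. x ^ j)"
    using proj_product_spectrum[OF A B] by metis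
  have "P.mixed_trace \<alpha> \<beta> 0 k = mat_trace (P.C \<alpha> \<beta> ^\<^sub>m k)"
    by (simp add: P.mixed_trace_def left_mult_one_mat[of _ n n])
  then have "W = P.mixed_trace \<alpha> \<beta> 0 k / of_nat n" by (simp add: W_def P.C_def)
  also have "\<dots> = (of_real (\<Sum>x\<leftarrow>xs. cheb m q k x)
     + (of_nat n - mat_trace A - mat_trace B) * of_real ((\<alpha> * \<beta>) ^ k)
     + (mat_trace A - of_nat n) * of_real ((- (1 - \<alpha>) * \<beta>) ^ k)
     + (mat_trace B - of_nat n) * of_real ((- \<alpha> * (1 - \<beta>)) ^ k)) / of_nat n"
    unfolding P.mixed_trace_eq[of xs, OF xs(2)] m_def q_def by simp
  also have "(S + (c - a - b) * y + (a - c) * u + (b - c) * v) / c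
      = S / c + (1 - a / c - b / c) * y + (a / c - 1) * u + (b / c - 1) * v"
    if "c \<noteq> 0" for S c a b y u v :: complex
    using that by (simp add: diff_divide_distrib add_divide_distrib algebra_simps)
  finally show ?thesis
    using n by (simp add: xs(1) tA_def tB_def)
qed

lemma esd_cheb_deviation:
  fixes k :: nat
  assumes A: "orth_proj_mat n A" and B: "orth_proj_mat n B" and n: "n > 0" and k: "k > 0"
  defines "W \<equiv> mat_trace (((A - of_real \<alpha> \<cdot>\<^sub>m 1\<^sub>m n) * (B - of_real \<beta> \<cdot>\<^sub>m 1\<^sub>m n)) ^\<^sub>m k) / of_nat n"
    and "tA \<equiv> mat_trace A / of_nat n" and "tB \<equiv> mat_trace B / of_nat n"
  shows "(esd_integral (A * B * A) (cheb m q k) - manova_integral \<alpha> \<beta> (cheb m q k))\<^sup>2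
    \<le> 3 * (cmod W)\<^sup>2 + 12 * (cmod (tA - of_real \<alpha>))\<^sup>2 + 12 * (cmod (tB - of_real \<beta>))\<^sup>2"
proof -
  let ?y = "(\<alpha> * \<beta>) ^ k" and ?u = "(- (1 - \<alpha>) * \<beta>) ^ k" and ?v = "(- \<alpha> * (1 - \<beta>)) ^ k"
  let ?d = "esd_integral (A * B * A) (cheb m q k) - manova_integral \<alpha> \<beta> (cheb m q k)"
  have pw: "\<bar>x ^ k\<bar> \<le> 1" if "\<bar>x\<bar> \<le> 1" for x :: real using that by (simp add: power_abs power_le_one)
  have "\<bar>\<alpha> * \<beta>\<bar> \<le> 1" "\<bar>- (1 - \<alpha>) * \<beta>\<bar> \<le> 1" "\<bar>- \<alpha> * (1 - \<beta>)\<bar> \<le> 1"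
    using \<alpha> \<beta> by (auto simp: abs_mult intro!: mult_le_one)
  then have yuv: "\<bar>?y\<bar> \<le> 1" "\<bar>?u\<bar> \<le> 1" "\<bar>?v\<bar> \<le> 1" using pw by blast+
  have "complex_of_real ?d = W + (tA - of_real \<alpha>) * of_real (?y - ?u) + (tB - of_real \<beta>) * of_real (?y - ?v)"
    using trace_mixed_pow[OF A B n, of k, folded W_def tA_def tB_def] k
    unfolding manova_integral_cheb_eq by (simp add: algebra_simps del: of_real_power)
  then have "\<bar>?d\<bar> = cmod (W + (tA - of_real \<alpha>) * of_real (?y - ?u) + (tB - of_real \<beta>) * of_real (?y - ?v))"
    by (metis norm_of_real)
  also have "\<dots> \<le> cmod W + cmod (tA - of_real \<alpha>) * \<bar>?y - ?u\<bar> + cmod (tB - of_real \<beta>) * \<bar>?y - ?v\<bar>"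
    by (intro norm_triangle_le add_mono) (simp_all add: norm_mult del: of_real_diff)
  also have "\<dots> \<le> cmod W + cmod (tA - of_real \<alpha>) * 2 + cmod (tB - of_real \<beta>) * 2"
  proof -
    have "\<bar>?y - ?u\<bar> \<le> 2" "\<bar>?y - ?v\<bar> \<le> 2" using yuv by linarith+
    then show ?thesis by (intro add_mono mult_left_mono) auto
  qed
  finally have "?d\<^sup>2 \<le> (cmod W + cmod (tA - of_real \<alpha>) * 2 + cmod (tB - of_real \<beta>) * 2)\<^sup>2"
    by (metis abs_ge_zero power2_abs power_mono)
  also have "(x + y * 2 + z * 2)\<^sup>2 \<le> 3 * x\<^sup>2 + 12 * y\<^sup>2 + 12 * z\<^sup>2" for x y z :: real
  proof -
    \<comment> \<open>Cauchy-Schwarz for three summands gives the factor 3; the coefficient 2 of y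
      and z turns it into 12.\<close>
    have "0 \<le> (x - 2 * y)\<^sup>2 + (x - 2 * z)\<^sup>2 + (2 * y - 2 * z)\<^sup>2" by simp
    then show ?thesis by (simp add: power2_eq_square algebra_simps)
  qed
  finally show ?thesis .
qed

lemma cheb_bounded: "\<exists>K. \<forall>x\<in>{0..1}. \<bar>cheb m q k x\<bar> \<le> K"
proof -
  have "compact (cheb m q k ` {0..1})"
    by (intro compact_continuous_image continuous_on_subset[OF continuous_on_cheb]) auto
  then have "bounded (cheb m q k ` {0..1})" by (rule compact_imp_bounded)
  then show ?thesis unfolding bounded_iff by auto
qed

text \<open>A bound independent of the dimension, from the Chebyshev polynomial being bounded on
  [0, 1]. It makes the squared mixed trace integrable, as monotonicity of the Bochner integral
  requires.\<close>

lemma norm_trace_mixed_pow_bounded: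
  "\<exists>K. \<forall>n A B. orth_proj_mat n A \<longrightarrow> orth_proj_mat n B \<longrightarrow> cmod (mat_trace
     (((A - of_real \<alpha> \<cdot>\<^sub>m 1\<^sub>m n) * (B - of_real \<beta> \<cdot>\<^sub>m 1\<^sub>m n)) ^\<^sub>m k) / of_nat n) \<le> K"
proof -
  obtain K where K: "\<And>x. x \<in> {0..1} \<Longrightarrow> \<bar>cheb m q k x\<bar> \<le> K" using cheb_bounded by blast
  show ?thesis
  proof (intro exI allI impI)
    fix n and A B :: "complex mat"
    assume AB: "orth_proj_mat n A" "orth_proj_mat n B"
    let ?W = "mat_trace (((A - of_real \<alpha> \<cdot>\<^sub>m 1\<^sub>m n) * (B - of_real \<beta> \<cdot>\<^sub>m 1\<^sub>m n)) ^\<^sub>m k) / of_nat n"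
    let ?y = "(\<alpha> * \<beta>) ^ k" and ?u = "(- (1 - \<alpha>) * \<beta>) ^ k" and ?v = "(- \<alpha> * (1 - \<beta>)) ^ k"
    define tA tB where "tA = mat_trace A / of_nat n" and "tB = mat_trace B / of_nat n"
    show "cmod ?W \<le> K + 3 * \<bar>?y\<bar> + 2 * \<bar>?u\<bar> + 2 * \<bar>?v\<bar>"
    proof (cases "n = 0")
      case True
      then show ?thesis using K[of 0] by (simp add: abs_le_iff)
    next
      case False
      have t: "cmod tA \<le> 1" "cmod tB \<le> 1"
        using norm_trace_orth_proj AB False by (auto simp: tA_def tB_def norm_divide divide_le_eq)
      then have "cmod (1 - tA - tB) \<le> 3" "cmod (tA - 1) \<le> 2" "cmod (tB - 1) \<le> 2"
        using norm_triangle_ineq4[of "1 - tA" tB] norm_triangle_ineq4[of 1 tA] norm_triangle_ineq4[of tA 1]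
          norm_triangle_ineq4[of tB 1] by auto
      then have "cmod (1 - tA - tB) * \<bar>?y\<bar> \<le> 3 * \<bar>?y\<bar>" "cmod (tA - 1) * \<bar>?u\<bar> \<le> 2 * \<bar>?u\<bar>"
        "cmod (tB - 1) * \<bar>?v\<bar> \<le> 2 * \<bar>?v\<bar>" by (auto intro!: mult_right_mono)
      moreover have "\<bar>esd_integral (A * B * A) (cheb m q k)\<bar> \<le> K"
        by (rule esd_integral_bound[OF AB K])
      moreover have "?W = of_real (esd_integral (A * B * A) (cheb m q k)) + (1 - tA - tB) * of_real ?y
          + (tA - 1) * of_real ?u + (tB - 1) * of_real ?v"
        using trace_mixed_pow[OF AB] False by (simp add: tA_def tB_def)
      then have "cmod ?W \<le> \<bar>esd_integral (A * B * A) (cheb m q k)\<bar> + cmod (1 - tA - tB) * \<bar>?y\<bar>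
          + cmod (tA - 1) * \<bar>?u\<bar> + cmod (tB - 1) * \<bar>?v\<bar>"
        by (simp only:) (intro norm_triangle_le add_mono, simp_all add: norm_mult del: of_real_power)
      ultimately show ?thesis by linarith
    qed
  qed
qed

end

section \<open>Convergence in probability\<close>

text \<open>Measurability is stated entry by entry, with the dimension fixed on the whole space,
  because \<open>$$\<close> is meaningful only inside the dimensions of the matrix.\<close>

definition measurable_mat :: "'w measure \<Rightarrow> nat \<Rightarrow> ('w \<Rightarrow> complex mat) \<Rightarrow> bool" where
  "measurable_mat M n X \<longleftrightarrow> (\<forall>\<omega>\<in>space M. X \<omega> \<in> carrier_mat n n) \<and>
     (\<forall>i<n. \<forall>j<n. (\<lambda>\<omega>. X \<omega> $$ (i,j)) \<in> borel_measurable M)"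

lemma measurable_matI:
  assumes "\<And>\<omega>. \<omega> \<in> space M \<Longrightarrow> X \<omega> \<in> carrier_mat n n"
    and "\<And>i j. i < n \<Longrightarrow> j < n \<Longrightarrow> g i j \<in> borel_measurable M"
    and "\<And>i j \<omega>. i < n \<Longrightarrow> j < n \<Longrightarrow> \<omega> \<in> space M \<Longrightarrow> X \<omega> $$ (i,j) = g i j \<omega>"
  shows "measurable_mat M n X"
  unfolding measurable_mat_def
proof (intro conjI ballI allI impI)
  fix i j assume ij: "i < n" "j < n"
  show "(\<lambda>\<omega>. X \<omega> $$ (i,j)) \<in> borel_measurable M"
    using assms(2)[OF ij] by (subst measurable_cong[of M _ "g i j"]) (auto simp: assms(3)[OF ij])
qed (use assms(1) in auto)

lemma measurable_mat_const: "Y \<in> carrier_mat n n \<Longrightarrow> measurable_mat M n (\<lambda>_. Y)"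
  by (auto simp: measurable_mat_def)

lemma measurable_mat_diff:
  assumes "measurable_mat M n X" "measurable_mat M n Y"
  shows "measurable_mat M n (\<lambda>\<omega>. X \<omega> - Y \<omega>)"
  by (rule measurable_matI[where g = "\<lambda>i j \<omega>. X \<omega> $$ (i,j) - Y \<omega> $$ (i,j)"])
    (use assms in \<open>auto simp: measurable_mat_def minus_carrier_mat intro!: borel_measurable_diff\<close>)

lemma measurable_mat_mult:
  assumes "measurable_mat M n X" "measurable_mat M n Y"
  shows "measurable_mat M n (\<lambda>\<omega>. X \<omega> * Y \<omega>)"
proof (rule measurable_matI[where g = "\<lambda>i j \<omega>. \<Sum>k<n. X \<omega> $$ (i,k) * Y \<omega> $$ (k,j)"])
  show "X \<omega> * Y \<omega> \<in> carrier_mat n n" if "\<omega> \<in> space M" for \<omega>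
    using assms that by (auto simp: measurable_mat_def intro!: mult_carrier_mat[of _ n n _ n])
  show "(\<lambda>\<omega>. \<Sum>k<n. X \<omega> $$ (i,k) * Y \<omega> $$ (k,j)) \<in> borel_measurable M" if "i < n" "j < n" for i j
    using assms that by (intro borel_measurable_sum borel_measurable_times) (auto simp: measurable_mat_def)
  fix i j \<omega> assume *: "i < n" "j < n" "\<omega> \<in> space M"
  then have "X \<omega> \<in> carrier_mat n n" "Y \<omega> \<in> carrier_mat n n" using assms by (auto simp: measurable_mat_def)
  then show "(X \<omega> * Y \<omega>) $$ (i,j) = (\<Sum>k<n. X \<omega> $$ (i,k) * Y \<omega> $$ (k,j))"
    using * by (auto simp: scalar_prod_def atLeast0LessThan intro!: sum.cong)
qed

lemma measurable_mat_pow: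
  assumes X: "measurable_mat M n X"
  shows "measurable_mat M n (\<lambda>\<omega>. X \<omega> ^\<^sub>m k)"
proof (induction k)
  case 0
  show ?case
    by (rule measurable_matI[where g = "\<lambda>i j \<omega>. (1\<^sub>m n) $$ (i,j)"])
      (use X in \<open>auto simp: measurable_mat_def\<close>)
next
  case (Suc k)
  then show ?case using measurable_mat_mult[OF _ X] by simp
qed

lemma measurable_mat_trace:
  assumes X: "measurable_mat M n X"
  shows "(\<lambda>\<omega>. mat_trace (X \<omega>)) \<in> borel_measurable M"
proof -
  have "(\<lambda>\<omega>. \<Sum>i<n. X \<omega> $$ (i,i)) \<in> borel_measurable M"
    using X by (intro borel_measurable_sum) (auto simp: measurable_mat_def)
  then show ?thesis
    by (subst measurable_cong[of M _ "\<lambda>\<omega>. \<Sum>i<n. X \<omega> $$ (i,i)"])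
      (use X in \<open>auto simp: measurable_mat_def mat_trace_def\<close>)
qed

locale random_projections = manova_params \<alpha> \<beta> for \<alpha> \<beta> :: real +
  fixes M :: "nat \<Rightarrow> 'w measure"
    and N :: "nat \<Rightarrow> nat"
    and A B :: "nat \<Rightarrow> 'w \<Rightarrow> complex mat"
  assumes prob: "\<And>\<iota>. prob_space (M \<iota>)"
    and incN: "strict_mono N"
    and projA: "\<And>\<iota> \<omega>. \<omega> \<in> space (M \<iota>) \<Longrightarrow> orth_proj_mat (N \<iota>) (A \<iota> \<omega>)"
    and projB: "\<And>\<iota> \<omega>. \<omega> \<in> space (M \<iota>) \<Longrightarrow> orth_proj_mat (N \<iota>) (B \<iota> \<omega>)"
    and measA: "\<And>\<iota> i j. i < N \<iota> \<Longrightarrow> j < N \<iota> \<Longrightarrow>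
                  (\<lambda>\<omega>. A \<iota> \<omega> $$ (i,j)) \<in> borel_measurable (M \<iota>)"
    and measB: "\<And>\<iota> i j. i < N \<iota> \<Longrightarrow> j < N \<iota> \<Longrightarrow>
                  (\<lambda>\<omega>. B \<iota> \<omega> $$ (i,j)) \<in> borel_measurable (M \<iota>)"
    and trA: "(\<lambda>\<iota>. \<integral>\<omega>. (cmod (mat_trace (A \<iota> \<omega>) / of_nat (N \<iota>) - of_real \<alpha>))\<^sup>2 \<partial>M \<iota>)
                \<longlonglongrightarrow> 0"
    and trB: "(\<lambda>\<iota>. \<integral>\<omega>. (cmod (mat_trace (B \<iota> \<omega>) / of_nat (N \<iota>) - of_real \<beta>))\<^sup>2 \<partial>M \<iota>)
                \<longlonglongrightarrow> 0"
    and mixed: "\<And>k::nat. k \<ge> 1 \<Longrightarrow>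
       (\<lambda>\<iota>. \<integral>\<omega>. (cmod (mat_trace
           (((A \<iota> \<omega> - of_real \<alpha> \<cdot>\<^sub>m 1\<^sub>m (N \<iota>)) * (B \<iota> \<omega> - of_real \<beta> \<cdot>\<^sub>m 1\<^sub>m (N \<iota>))) ^\<^sub>m k)
           / of_nat (N \<iota>)))\<^sup>2 \<partial>M \<iota>) \<longlonglongrightarrow> 0"
begin

definition E :: "(real \<Rightarrow> real) \<Rightarrow> nat \<Rightarrow> 'w \<Rightarrow> real" where
  "E f \<iota> \<omega> = esd_integral (A \<iota> \<omega> * B \<iota> \<omega> * A \<iota> \<omega>) f"

abbreviation \<mu> where "\<mu> \<equiv> manova_integral \<alpha> \<beta>"

lemma E_add: "E (\<lambda>x. f x + g x) \<iota> \<omega> = E f \<iota> \<omega> + E g \<iota> \<omega>"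
  and E_cmult: "E (\<lambda>x. c * f x) \<iota> \<omega> = c * E f \<iota> \<omega>"
  by (simp_all add: E_def esd_integral_add esd_integral_cmult)

lemma E_bound:
  assumes "\<omega> \<in> space (M \<iota>)" "\<And>x. x \<in> {0..1} \<Longrightarrow> \<bar>f x\<bar> \<le> \<delta>"
  shows "\<bar>E f \<iota> \<omega>\<bar> \<le> \<delta>"
  unfolding E_def by (rule esd_integral_bound[OF projA projB]) (use assms in auto)

lemma mat_A: "measurable_mat (M \<iota>) (N \<iota>) (A \<iota>)"
  and mat_B: "measurable_mat (M \<iota>) (N \<iota>) (B \<iota>)"
  using orth_proj_matD(1)[OF projA] orth_proj_matD(1)[OF projB] measA measB
  by (simp_all add: measurable_mat_def)

lemma E_power_measurable: "E (\<lambda>x. x ^ j) \<iota> \<in> borel_measurable (M \<iota>)"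
proof -
  have "(\<lambda>\<omega>. mat_trace ((A \<iota> \<omega> * B \<iota> \<omega> * A \<iota> \<omega>) ^\<^sub>m j)) \<in> borel_measurable (M \<iota>)"
    by (rule measurable_mat_trace[OF measurable_mat_pow[OF measurable_mat_mult[OF measurable_mat_mult[OF mat_A mat_B] mat_A]]])
  then have "(\<lambda>\<omega>. Re (mat_trace ((A \<iota> \<omega> * B \<iota> \<omega> * A \<iota> \<omega>) ^\<^sub>m j)) / real (N \<iota>)) \<in> borel_measurable (M \<iota>)"
    by measurable
  then show ?thesis
    by (subst measurable_cong) (auto simp: E_def esd_integral_power[OF projA projB])
qed

lemma E_polynomial:
  "E (\<lambda>x. \<Sum>i\<le>n. a i * x ^ i) \<iota> \<omega> = (\<Sum>i\<le>n. a i * E (\<lambda>x. x ^ i) \<iota> \<omega>)" for n :: nat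
proof (induction n)
  case (Suc n)
  show ?case by (simp add: E_add Suc E_cmult del: power_Suc)
qed (use E_cmult[of "a 0" "\<lambda>x. 1"] in simp)

lemma E_diff_le:
  assumes "\<omega> \<in> space (M \<iota>)" "\<And>x. x \<in> {0..1} \<Longrightarrow> \<bar>f x - g x\<bar> \<le> \<delta>"
  shows "\<bar>E f \<iota> \<omega> - E g \<iota> \<omega>\<bar> \<le> \<delta>"
proof -
  have "E (\<lambda>x. f x + (- 1) * g x) \<iota> \<omega> = E f \<iota> \<omega> - E g \<iota> \<omega>" unfolding E_add E_cmult by simp
  then show ?thesis using E_bound[OF assms(1), of "\<lambda>x. f x + (- 1) * g x"] assms(2) by simp
qed

lemma manova_diff_le:
  assumes "continuous_on UNIV f" "continuous_on UNIV g" "\<And>x. x \<in> {0..1} \<Longrightarrow> \<bar>f x - g x\<bar> \<le> \<delta>"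
  shows "\<bar>\<mu> f - \<mu> g\<bar> \<le> \<delta>"
proof -
  have g': "continuous_on UNIV (\<lambda>x. (- 1) * g x)" using assms(2) by (intro continuous_intros)
  have "\<mu> (\<lambda>x. f x + (- 1) * g x) = \<mu> f - \<mu> g"
    unfolding manova_integral_add[OF assms(1) g'] manova_integral_cmult by simp
  moreover have "\<bar>\<mu> (\<lambda>x. f x + (- 1) * g x)\<bar> \<le> \<delta>"
    using assms(3) by (intro manova_integral_bound continuous_on_add assms(1) g') auto
  ultimately show ?thesis by simp
qed

lemma polynomial_approx:
  assumes f: "continuous_on UNIV f" and e: "0 < (e::real)"
  obtains a n where "\<And>x. x \<in> {0..1::real} \<Longrightarrow> \<bar>f x - (\<Sum>i\<le>n. a i * x ^ i)\<bar> \<le> e"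
proof -
  obtain g where g: "real_polynomial_function g" "\<And>x. x \<in> {0..1} \<Longrightarrow> \<bar>f x - g x\<bar> < e"
    using Stone_Weierstrass_real_polynomial_function[of "{0..1}" f e] f e
    by (metis compact_Icc continuous_on_subset subset_UNIV)
  obtain a n where "g = (\<lambda>x. \<Sum>i\<le>n. a i * x ^ i)"
    using g(1) unfolding real_polynomial_function_iff_sum by blast
  then show thesis using g(2) that[of a n] by (simp add: less_imp_le)
qed

text \<open>Measurability of the eigenvalues is bypassed. Moments are traces, hence polynomials in
  the entries; a continuous \<open>f\<close> is a uniform limit of polynomials on [0, 1], and its
  spectral integral is the pointwise limit of theirs.\<close>

lemma E_measurable:
  assumes f: "continuous_on UNIV f"
  shows "E f \<iota> \<in> borel_measurable (M \<iota>)"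
proof -
  have "\<exists>a n. \<forall>x\<in>{0..1}. \<bar>f x - (\<Sum>i\<le>n. a i * x ^ i)\<bar> \<le> inverse (real (Suc j))" for j
    using polynomial_approx[OF f, of "inverse (real (Suc j))"] by (metis inverse_positive_iff_positive of_nat_0_less_iff zero_less_Suc)
  then obtain a n where an: "\<And>j x. x \<in> {0..1} \<Longrightarrow> \<bar>f x - (\<Sum>i\<le>n j. a j i * x ^ i)\<bar> \<le> inverse (real (Suc j))"
    by metis
  define p where "p j = (\<lambda>x::real. \<Sum>i\<le>n j. a j i * x ^ i)" for j :: nat
  show ?thesis
  proof (rule borel_measurable_LIMSEQ_real)
    show "E (p j) \<iota> \<in> borel_measurable (M \<iota>)" for j
    proof -
      have "(\<lambda>\<omega>. \<Sum>i\<le>n j. a j i * E (\<lambda>x. x ^ i) \<iota> \<omega>) \<in> borel_measurable (M \<iota>)"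
        using E_power_measurable by (intro borel_measurable_sum borel_measurable_times) auto
      then show ?thesis by (simp add: p_def E_polynomial[abs_def] cong: measurable_cong)
    qed
    fix \<omega> assume \<omega>: "\<omega> \<in> space (M \<iota>)"
    have "(\<lambda>j. E (p j) \<iota> \<omega> - E f \<iota> \<omega>) \<longlonglongrightarrow> 0"
    proof (rule Lim_null_comparison[OF _ LIMSEQ_inverse_real_of_nat])
      have "\<bar>E f \<iota> \<omega> - E (p j) \<iota> \<omega>\<bar> \<le> inverse (real (Suc j))" for j
        by (rule E_diff_le[OF \<omega>]) (use an in \<open>simp add: p_def\<close>)
      then show "\<forall>\<^sub>F j in sequentially. norm (E (p j) \<iota> \<omega> - E f \<iota> \<omega>) \<le> inverse (real (Suc j))"
        by (simp add: abs_minus_commute)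
    qed
    then show "(\<lambda>j. E (p j) \<iota> \<omega>) \<longlonglongrightarrow> E f \<iota> \<omega>" by (simp add: LIM_zero_iff)
  qed
qed

section \<open>Mean-square convergence of spectral integrals\<close>

lemma integrable_bounded:
  assumes "g \<in> borel_measurable (M \<iota>)" "\<And>\<omega>. \<omega> \<in> space (M \<iota>) \<Longrightarrow> \<bar>g \<omega>\<bar> \<le> K"
  shows "integrable (M \<iota>) (\<lambda>\<omega>. (g \<omega>)\<^sup>2 :: real)"
proof -
  interpret prob_space "M \<iota>" by (rule prob)
  have "(g \<omega>)\<^sup>2 \<le> K\<^sup>2" if "\<omega> \<in> space (M \<iota>)" for \<omega>
    using power_mono[OF assms(2)[OF that] abs_ge_zero, of 2] by simp
  then show ?thesis
    using assms(1) by (intro integrable_const_bound[of _ "K\<^sup>2"]) auto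
qed

lemma deviation_integrable:
  assumes f: "continuous_on UNIV f"
  shows "integrable (M \<iota>) (\<lambda>\<omega>. (E f \<iota> \<omega> - c)\<^sup>2)"
proof -
  have "compact (f ` {0..1})"
    by (intro compact_continuous_image continuous_on_subset[OF f]) auto
  then have "bounded (f ` {0..1})" by (rule compact_imp_bounded)
  then obtain K where "\<forall>y\<in>f ` {0..1}. norm y \<le> K" unfolding bounded_iff ..
  then have K: "\<bar>f x\<bar> \<le> K" if "x \<in> {0..1}" for x using that by auto
  show ?thesis
  proof (rule integrable_bounded)
    show "(\<lambda>\<omega>. E f \<iota> \<omega> - c) \<in> borel_measurable (M \<iota>)" using E_measurable[OF f] by auto
    show "\<bar>E f \<iota> \<omega> - c\<bar> \<le> K + \<bar>c\<bar>" if "\<omega> \<in> space (M \<iota>)" for \<omega>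
      using E_bound[OF that, of f K] K by force
  qed
qed

text \<open>Continuity is part of the predicate because measurability of \<open>E f\<close> and
  additivity of \<open>\<mu>\<close> rely on it.\<close>

definition L2_conv :: "(real \<Rightarrow> real) \<Rightarrow> bool" where
  "L2_conv f \<longleftrightarrow> continuous_on UNIV f \<and> (\<lambda>\<iota>. \<integral>\<omega>. (E f \<iota> \<omega> - \<mu> f)\<^sup>2 \<partial>M \<iota>) \<longlonglongrightarrow> 0"

lemma L2_conv_cont: "L2_conv f \<Longrightarrow> continuous_on UNIV f"
  by (simp add: L2_conv_def)

lemma L2_conv_comparison:
  assumes f: "continuous_on UNIV f" and g: "g \<longlonglongrightarrow> 0"
    and le: "\<forall>\<^sub>F \<iota> in sequentially. (\<integral>\<omega>. (E f \<iota> \<omega> - \<mu> f)\<^sup>2 \<partial>M \<iota>) \<le> g \<iota>"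
  shows "L2_conv f"
  unfolding L2_conv_def
proof (intro conjI f)
  show "(\<lambda>\<iota>. \<integral>\<omega>. (E f \<iota> \<omega> - \<mu> f)\<^sup>2 \<partial>M \<iota>) \<longlonglongrightarrow> 0"
    by (rule Lim_null_comparison[OF _ g], rule eventually_mono[OF le]) simp
qed

lemma L2_conv_add:
  assumes f: "L2_conv f" and g: "L2_conv g"
  shows "L2_conv (\<lambda>x. f x + g x)"
proof (rule L2_conv_comparison)
  note cf = L2_conv_cont[OF f] and cg = L2_conv_cont[OF g]
  show c: "continuous_on UNIV (\<lambda>x. f x + g x)" using cf cg by (intro continuous_intros)
  have "(\<lambda>\<iota>. 2 * (\<integral>\<omega>. (E f \<iota> \<omega> - \<mu> f)\<^sup>2 \<partial>M \<iota>) + 2 * (\<integral>\<omega>. (E g \<iota> \<omega> - \<mu> g)\<^sup>2 \<partial>M \<iota>)) \<longlonglongrightarrow> 2 * 0 + 2 * 0"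
    using f g by (intro tendsto_intros) (auto simp: L2_conv_def)
  then show "(\<lambda>\<iota>. 2 * (\<integral>\<omega>. (E f \<iota> \<omega> - \<mu> f)\<^sup>2 \<partial>M \<iota>) + 2 * (\<integral>\<omega>. (E g \<iota> \<omega> - \<mu> g)\<^sup>2 \<partial>M \<iota>)) \<longlonglongrightarrow> 0" by simp
  have "(\<integral>\<omega>. (E (\<lambda>x. f x + g x) \<iota> \<omega> - \<mu> (\<lambda>x. f x + g x))\<^sup>2 \<partial>M \<iota>)
    \<le> (\<integral>\<omega>. 2 * (E f \<iota> \<omega> - \<mu> f)\<^sup>2 + 2 * (E g \<iota> \<omega> - \<mu> g)\<^sup>2 \<partial>M \<iota>)" for \<iota>
  proof (rule integral_mono)
    fix \<omega>
    have "(x + y)\<^sup>2 \<le> 2 * x\<^sup>2 + 2 * y\<^sup>2" for x y :: real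
      using zero_le_power2[of "x - y"] by (simp add: power2_eq_square algebra_simps)
    from this[of "E f \<iota> \<omega> - \<mu> f" "E g \<iota> \<omega> - \<mu> g"]
    show "(E (\<lambda>x. f x + g x) \<iota> \<omega> - \<mu> (\<lambda>x. f x + g x))\<^sup>2 \<le> 2 * (E f \<iota> \<omega> - \<mu> f)\<^sup>2 + 2 * (E g \<iota> \<omega> - \<mu> g)\<^sup>2"
      unfolding E_add manova_integral_add[OF cf cg] by (simp add: algebra_simps)
  qed (use deviation_integrable[OF c] deviation_integrable[OF cf] deviation_integrable[OF cg] in auto)
  then show "\<forall>\<^sub>F \<iota> in sequentially. (\<integral>\<omega>. (E (\<lambda>x. f x + g x) \<iota> \<omega> - \<mu> (\<lambda>x. f x + g x))\<^sup>2 \<partial>M \<iota>)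
    \<le> 2 * (\<integral>\<omega>. (E f \<iota> \<omega> - \<mu> f)\<^sup>2 \<partial>M \<iota>) + 2 * (\<integral>\<omega>. (E g \<iota> \<omega> - \<mu> g)\<^sup>2 \<partial>M \<iota>)"
    using deviation_integrable[OF cf] deviation_integrable[OF cg] by simp
qed

lemma L2_conv_cmult:
  assumes f: "L2_conv f"
  shows "L2_conv (\<lambda>x. c * f x)"
  unfolding L2_conv_def
proof
  show "continuous_on UNIV (\<lambda>x. c * f x)" using L2_conv_cont[OF f] by (intro continuous_intros)
  have "(\<integral>\<omega>. (E (\<lambda>x. c * f x) \<iota> \<omega> - \<mu> (\<lambda>x. c * f x))\<^sup>2 \<partial>M \<iota>) = c\<^sup>2 * (\<integral>\<omega>. (E f \<iota> \<omega> - \<mu> f)\<^sup>2 \<partial>M \<iota>)" for \<iota>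
    unfolding E_cmult manova_integral_cmult right_diff_distrib[symmetric] power_mult_distrib by simp
  moreover have "(\<lambda>\<iota>. c\<^sup>2 * (\<integral>\<omega>. (E f \<iota> \<omega> - \<mu> f)\<^sup>2 \<partial>M \<iota>)) \<longlonglongrightarrow> c\<^sup>2 * 0"
    using f by (intro tendsto_intros) (auto simp: L2_conv_def)
  ultimately show "(\<lambda>\<iota>. \<integral>\<omega>. (E (\<lambda>x. c * f x) \<iota> \<omega> - \<mu> (\<lambda>x. c * f x))\<^sup>2 \<partial>M \<iota>) \<longlonglongrightarrow> 0" by simp
qed

text \<open>Strict monotonicity gives \<open>N \<iota> \<ge> \<iota>\<close>, so at most the initial
  matrix is empty. This is why later comparisons hold only eventually.\<close>

lemma N_pos: "\<iota> \<ge> 1 \<Longrightarrow> N \<iota> > 0"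
  using strict_mono_imp_increasing[OF incN, of \<iota>] by simp

lemma L2_conv_cheb_pos:
  assumes k: "k > 0"
  shows "L2_conv (cheb m q k)"
proof (rule L2_conv_comparison[OF continuous_on_cheb])
  define W where "W \<iota> \<omega> = mat_trace (((A \<iota> \<omega> - of_real \<alpha> \<cdot>\<^sub>m 1\<^sub>m (N \<iota>)) * (B \<iota> \<omega> - of_real \<beta> \<cdot>\<^sub>m 1\<^sub>m (N \<iota>))) ^\<^sub>m k)
           / of_nat (N \<iota>)" for \<iota> \<omega>
  define a where "a \<iota> \<omega> = mat_trace (A \<iota> \<omega>) / of_nat (N \<iota>) - of_real \<alpha>" for \<iota> \<omega>
  define b where "b \<iota> \<omega> = mat_trace (B \<iota> \<omega>) / of_nat (N \<iota>) - of_real \<beta>" for \<iota> \<omega>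
  let ?g = "\<lambda>\<iota>. 3 * (\<integral>\<omega>. (cmod (W \<iota> \<omega>))\<^sup>2 \<partial>M \<iota>) + 12 * (\<integral>\<omega>. (cmod (a \<iota> \<omega>))\<^sup>2 \<partial>M \<iota>) + 12 * (\<integral>\<omega>. (cmod (b \<iota> \<omega>))\<^sup>2 \<partial>M \<iota>)"
  have "?g \<longlonglongrightarrow> 3 * 0 + 12 * 0 + 12 * 0"
    unfolding W_def a_def b_def using k by (intro tendsto_add tendsto_mult_left trA trB mixed) simp
  then show "?g \<longlonglongrightarrow> 0" by simp
  have meas_shift: "measurable_mat (M \<iota>) (N \<iota>) (\<lambda>\<omega>. X \<omega> - c \<cdot>\<^sub>m 1\<^sub>m (N \<iota>))"
    if "measurable_mat (M \<iota>) (N \<iota>) X" for X c \<iota>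
    using that by (intro measurable_mat_diff measurable_mat_const) auto
  \<comment> \<open>Integrability is established separately: convergence of the integrals to 0 does
    not entail it, since a non-integrable function has Bochner integral 0.\<close>
  have W_int: "integrable (M \<iota>) (\<lambda>\<omega>. (cmod (W \<iota> \<omega>))\<^sup>2)" for \<iota>
  proof -
    obtain K where K: "\<forall>n A B. orth_proj_mat n A \<longrightarrow> orth_proj_mat n B \<longrightarrow> cmod (mat_trace
     (((A - of_real \<alpha> \<cdot>\<^sub>m 1\<^sub>m n) * (B - of_real \<beta> \<cdot>\<^sub>m 1\<^sub>m n)) ^\<^sub>m k) / of_nat n) \<le> K"
      using norm_trace_mixed_pow_bounded by blast
    have "W \<iota> \<in> borel_measurable (M \<iota>)" unfolding W_def
      by (intro borel_measurable_divide borel_measurable_const measurable_mat_trace[OF measurable_mat_pow[OF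
          measurable_mat_mult[OF meas_shift[OF mat_A] meas_shift[OF mat_B]]]])
    then have "(\<lambda>\<omega>. cmod (W \<iota> \<omega>)) \<in> borel_measurable (M \<iota>)" by measurable
    then show ?thesis
    proof (rule integrable_bounded)
      show "\<bar>cmod (W \<iota> \<omega>)\<bar> \<le> K" if "\<omega> \<in> space (M \<iota>)" for \<omega>
        using K projA[OF that] projB[OF that] by (simp add: W_def)
    qed
  qed
  have ab_int: "integrable (M \<iota>) (\<lambda>\<omega>. (cmod (mat_trace (X \<omega>) / of_nat (N \<iota>) - of_real c))\<^sup>2)"
    if X: "measurable_mat (M \<iota>) (N \<iota>) X" "\<And>\<omega>. \<omega> \<in> space (M \<iota>) \<Longrightarrow> orth_proj_mat (N \<iota>) (X \<omega>)" for X c \<iota>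
  proof (rule integrable_bounded)
    show "(\<lambda>\<omega>. cmod (mat_trace (X \<omega>) / of_nat (N \<iota>) - of_real c)) \<in> borel_measurable (M \<iota>)"
      using measurable_mat_trace[OF X(1)] by measurable
    fix \<omega> assume \<omega>: "\<omega> \<in> space (M \<iota>)"
    have "cmod (mat_trace (X \<omega>) / of_nat (N \<iota>)) \<le> 1"
      using norm_trace_orth_proj[OF X(2)[OF \<omega>]] by (auto simp: norm_divide divide_le_eq_1)
    then show "\<bar>cmod (mat_trace (X \<omega>) / of_nat (N \<iota>) - of_real c)\<bar> \<le> 1 + \<bar>c\<bar>"
      using norm_triangle_ineq4[of "mat_trace (X \<omega>) / of_nat (N \<iota>)" "of_real c"] by simp
  qed
  have int: "integrable (M \<iota>) (\<lambda>\<omega>. (cmod (a \<iota> \<omega>))\<^sup>2)" "integrable (M \<iota>) (\<lambda>\<omega>. (cmod (b \<iota> \<omega>))\<^sup>2)" for \<iota>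
    unfolding a_def b_def using projA projB by (intro ab_int mat_A mat_B; blast)+
  have "(\<integral>\<omega>. (E (cheb m q k) \<iota> \<omega> - \<mu> (cheb m q k))\<^sup>2 \<partial>M \<iota>) \<le> ?g \<iota>" if "\<iota> \<ge> 1" for \<iota>
  proof -
    have "(\<integral>\<omega>. (E (cheb m q k) \<iota> \<omega> - \<mu> (cheb m q k))\<^sup>2 \<partial>M \<iota>)
       \<le> (\<integral>\<omega>. 3 * (cmod (W \<iota> \<omega>))\<^sup>2 + 12 * (cmod (a \<iota> \<omega>))\<^sup>2 + 12 * (cmod (b \<iota> \<omega>))\<^sup>2 \<partial>M \<iota>)"
    proof (rule integral_mono)
      fix \<omega> assume "\<omega> \<in> space (M \<iota>)"
      from esd_cheb_deviation[OF projA[OF this] projB[OF this] N_pos[OF that] k]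
      show "(E (cheb m q k) \<iota> \<omega> - \<mu> (cheb m q k))\<^sup>2
          \<le> 3 * (cmod (W \<iota> \<omega>))\<^sup>2 + 12 * (cmod (a \<iota> \<omega>))\<^sup>2 + 12 * (cmod (b \<iota> \<omega>))\<^sup>2"
        unfolding E_def W_def a_def b_def .
    qed (use deviation_integrable[OF continuous_on_cheb] W_int int in auto)
    then show ?thesis using W_int int by simp
  qed
  then show "\<forall>\<^sub>F \<iota> in sequentially. (\<integral>\<omega>. (E (cheb m q k) \<iota> \<omega> - \<mu> (cheb m q k))\<^sup>2 \<partial>M \<iota>) \<le> ?g \<iota>"
    unfolding eventually_sequentially by blast
qed

lemma E_one:
  assumes "N \<iota> > 0" "\<omega> \<in> space (M \<iota>)"
  shows "E (\<lambda>x. 1) \<iota> \<omega> = 1"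
proof -
  show ?thesis unfolding E_def
    by (rule proj_product_spectrum[OF projA[OF assms(2)] projB[OF assms(2)]])
      (use assms(1) in \<open>simp add: sum_list_triv\<close>)
qed

text \<open>The mixed traces cover only k \<ge> 1. For k = 0 the polynomial is constant and the
  deviation is exactly 0 once the matrices are nonempty.\<close>

lemma L2_conv_cheb: "L2_conv (cheb m q k)"
proof (cases "k = 0")
  case True
  have c: "cheb m q 0 = (\<lambda>x. 2 * 1)" by auto
  have "(\<integral>\<omega>. (E (cheb m q 0) \<iota> \<omega> - \<mu> (cheb m q 0))\<^sup>2 \<partial>M \<iota>) = 0" if "\<iota> \<ge> 1" for \<iota>
  proof -
    have "(\<integral>\<omega>. (E (cheb m q 0) \<iota> \<omega> - \<mu> (cheb m q 0))\<^sup>2 \<partial>M \<iota>) = (\<integral>\<omega>. 0 \<partial>M \<iota>)"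
      using E_one N_pos[OF that] manova_integral_cheb_eq[of 0]
      by (intro Bochner_Integration.integral_cong) (auto simp: c E_cmult[of 2 "\<lambda>x. 1", simplified])
    then show ?thesis by simp
  qed
  then have "L2_conv (cheb m q 0)"
    by (intro L2_conv_comparison[OF continuous_on_cheb tendsto_const])
      (auto simp: eventually_sequentially intro!: exI[of _ 1])
  then show ?thesis using True by simp
qed (simp add: L2_conv_cheb_pos)

text \<open>Multiplication by x stays in the span of the Chebyshev polynomials: x P_k = P_{k+1} + m
  P_k + q P_{k-1} for k \<ge> 1, and x P_0 = 2 P_1 + m P_0 because P_0 = 2. Monomials are then
  reached at \<open>k = 0\<close>.\<close>

lemma L2_conv_power_cheb: "L2_conv (\<lambda>x. x ^ j * cheb m q k x)"
proof (induction j arbitrary: k)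
  case 0
  show ?case using L2_conv_cheb by simp
next
  case (Suc j)
  show ?case
  proof (cases k)
    case 0
    have "L2_conv (\<lambda>x. 2 * (x ^ j * cheb m q 1 x) + m * (x ^ j * cheb m q 0 x))"
      by (intro L2_conv_add L2_conv_cmult Suc)
    moreover have "(\<lambda>x. 2 * (x ^ j * cheb m q 1 x) + m * (x ^ j * cheb m q 0 x)) = (\<lambda>x. x ^ Suc j * cheb m q k x)"
      using 0 by (auto simp: algebra_simps)
    ultimately show ?thesis by simp
  next
    case (Suc i)
    have "L2_conv (\<lambda>x. x ^ j * cheb m q (Suc k) x + (m * (x ^ j * cheb m q k x) + q * (x ^ j * cheb m q i x)))"
      by (intro L2_conv_add L2_conv_cmult Suc.IH)
    moreover have "(\<lambda>x. x ^ j * cheb m q (Suc k) x + (m * (x ^ j * cheb m q k x) + q * (x ^ j * cheb m q i x)))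
        = (\<lambda>x. x ^ Suc j * cheb m q k x)"
      using Suc by (auto simp: algebra_simps)
    ultimately show ?thesis by simp
  qed
qed

lemma L2_conv_polynomial: "L2_conv (\<lambda>x. \<Sum>i\<le>n. a i * x ^ i)" for n :: nat
proof (induction n)
  have p: "L2_conv (\<lambda>x. c * x ^ j)" for c j
    using L2_conv_cmult[OF L2_conv_power_cheb[of j 0], of "c / 2"] by simp
  case 0
  show ?case using p[of "a 0" 0] by simp
  case (Suc n)
  show ?case using L2_conv_add[OF Suc p[of "a (Suc n)" "Suc n"]] by simp
qed

lemma deviation_measurable:
  assumes f: "continuous_on UNIV f"
  shows "{\<omega> \<in> space (M \<iota>). \<bar>E f \<iota> \<omega> - \<mu> f\<bar> > \<epsilon>} \<in> sets (M \<iota>)"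
  using E_measurable[OF f, of \<iota>] by measurable

text \<open>Replacing \<open>f\<close> by a polynomial costs \<epsilon>/4 in the spectral integral
  and \<epsilon>/4 in the limit, so a deviation above \<epsilon> for \<open>f\<close> forces one of
  at least \<epsilon>/2 for the polynomial.\<close>

lemma convergence_in_probability:
  assumes f: "continuous_on UNIV f" and e: "0 < \<epsilon>"
  shows "(\<lambda>\<iota>. measure (M \<iota>) {\<omega> \<in> space (M \<iota>). \<bar>E f \<iota> \<omega> - \<mu> f\<bar> > \<epsilon>}) \<longlonglongrightarrow> 0"
proof -
  obtain a n where an: "\<And>x. x \<in> {0..1::real} \<Longrightarrow> \<bar>f x - (\<Sum>i\<le>n. a i * x ^ i)\<bar> \<le> \<epsilon> / 4"
    using polynomial_approx[OF f, of "\<epsilon> / 4"] e by auto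
  define p where "p = (\<lambda>x::real. \<Sum>i\<le>n. a i * x ^ i)"
  have p: "L2_conv p" unfolding p_def by (rule L2_conv_polynomial)
  have cp: "continuous_on UNIV p" by (rule L2_conv_cont[OF p])
  have \<mu>fp: "\<bar>\<mu> f - \<mu> p\<bar> \<le> \<epsilon> / 4" using an by (intro manova_diff_le f cp) (simp add: p_def)
  have le: "measure (M \<iota>) {\<omega> \<in> space (M \<iota>). \<bar>E f \<iota> \<omega> - \<mu> f\<bar> > \<epsilon>}
      \<le> (\<integral>\<omega>. (E p \<iota> \<omega> - \<mu> p)\<^sup>2 \<partial>M \<iota>) / (\<epsilon> / 2)\<^sup>2" for \<iota>
  proof -
    interpret prob_space "M \<iota>" by (rule prob)
    have [measurable]: "E p \<iota> \<in> borel_measurable (M \<iota>)" by (rule E_measurable[OF cp])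
    have "measure (M \<iota>) {\<omega> \<in> space (M \<iota>). \<bar>E f \<iota> \<omega> - \<mu> f\<bar> > \<epsilon>}
        \<le> measure (M \<iota>) {\<omega> \<in> space (M \<iota>). (\<epsilon> / 2)\<^sup>2 \<le> (E p \<iota> \<omega> - \<mu> p)\<^sup>2}"
    proof (rule finite_measure_mono)
      show "{\<omega> \<in> space (M \<iota>). \<bar>E f \<iota> \<omega> - \<mu> f\<bar> > \<epsilon>} \<subseteq> {\<omega> \<in> space (M \<iota>). (\<epsilon> / 2)\<^sup>2 \<le> (E p \<iota> \<omega> - \<mu> p)\<^sup>2}"
      proof safe
        fix \<omega> assume \<omega>: "\<omega> \<in> space (M \<iota>)" and gt: "\<bar>E f \<iota> \<omega> - \<mu> f\<bar> > \<epsilon>"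
        have "\<bar>E f \<iota> \<omega> - E p \<iota> \<omega>\<bar> \<le> \<epsilon> / 4" using an by (intro E_diff_le[OF \<omega>]) (simp add: p_def)
        then have "\<epsilon> / 2 \<le> \<bar>E p \<iota> \<omega> - \<mu> p\<bar>" using gt \<mu>fp by linarith
        then show "(\<epsilon> / 2)\<^sup>2 \<le> (E p \<iota> \<omega> - \<mu> p)\<^sup>2" using e by (metis power2_abs power_mono half_gt_zero less_imp_le)
      qed
    qed measurable
    \<comment> \<open>Markov's inequality for the squared deviation, that is, Chebyshev's inequality
      about the deterministic limit.\<close>
    also have "\<dots> \<le> (\<integral>\<omega>. (E p \<iota> \<omega> - \<mu> p)\<^sup>2 \<partial>M \<iota>) / (\<epsilon> / 2)\<^sup>2"
      using e deviation_integrable[OF cp] by (intro integral_Markov_inequality_measure[of _ _ "{}"]) auto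
    finally show ?thesis .
  qed
  have lim: "(\<lambda>\<iota>. (\<integral>\<omega>. (E p \<iota> \<omega> - \<mu> p)\<^sup>2 \<partial>M \<iota>) / (\<epsilon> / 2)\<^sup>2) \<longlonglongrightarrow> 0"
    using p unfolding L2_conv_def by (intro tendsto_divide_zero) auto
  show ?thesis
    by (rule Lim_null_comparison[OF always_eventually lim]) (use le in simp)
qed

end

theorem theorem1p7:
  fixes M :: "nat \<Rightarrow> 'w measure"
    and N :: "nat \<Rightarrow> nat"
    and A B :: "nat \<Rightarrow> 'w \<Rightarrow> complex mat"
    and \<alpha> \<beta> :: real
  assumes prob: "\<And>\<iota>. prob_space (M \<iota>)"
    and incN: "strict_mono N"
    and projA: "\<And>\<iota> \<omega>. \<omega> \<in> space (M \<iota>) \<Longrightarrow> orth_proj_mat (N \<iota>) (A \<iota> \<omega>)"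
    and projB: "\<And>\<iota> \<omega>. \<omega> \<in> space (M \<iota>) \<Longrightarrow> orth_proj_mat (N \<iota>) (B \<iota> \<omega>)"
    and measA: "\<And>\<iota> i j. i < N \<iota> \<Longrightarrow> j < N \<iota> \<Longrightarrow>
                  (\<lambda>\<omega>. A \<iota> \<omega> $$ (i,j)) \<in> borel_measurable (M \<iota>)"
    and measB: "\<And>\<iota> i j. i < N \<iota> \<Longrightarrow> j < N \<iota> \<Longrightarrow>
                  (\<lambda>\<omega>. B \<iota> \<omega> $$ (i,j)) \<in> borel_measurable (M \<iota>)"
    and \<alpha>: "0 < \<alpha>" "\<alpha> < 1"
    and \<beta>: "0 < \<beta>" "\<beta> < 1"
    and trA: "(\<lambda>\<iota>. \<integral>\<omega>. (cmod (mat_trace (A \<iota> \<omega>) / of_nat (N \<iota>) - of_real \<alpha>))\<^sup>2 \<partial>M \<iota>)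
                \<longlonglongrightarrow> 0"
    and trB: "(\<lambda>\<iota>. \<integral>\<omega>. (cmod (mat_trace (B \<iota> \<omega>) / of_nat (N \<iota>) - of_real \<beta>))\<^sup>2 \<partial>M \<iota>)
                \<longlonglongrightarrow> 0"
    and mixed: "\<And>k::nat. k \<ge> 1 \<Longrightarrow>
       (\<lambda>\<iota>. \<integral>\<omega>. (cmod (mat_trace
           (((A \<iota> \<omega> - of_real \<alpha> \<cdot>\<^sub>m 1\<^sub>m (N \<iota>)) * (B \<iota> \<omega> - of_real \<beta> \<cdot>\<^sub>m 1\<^sub>m (N \<iota>))) ^\<^sub>m k)
           / of_nat (N \<iota>)))\<^sup>2 \<partial>M \<iota>) \<longlonglongrightarrow> 0"
  shows "\<And>f::real \<Rightarrow> real. continuous_on UNIV f \<Longrightarrow>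
           (\<exists>K. compact K \<and> (\<forall>x. x \<notin> K \<longrightarrow> f x = 0)) \<Longrightarrow>
           (\<forall>\<epsilon>>0.
              (\<forall>\<iota>. {\<omega> \<in> space (M \<iota>).
                     \<bar>esd_integral (A \<iota> \<omega> * B \<iota> \<omega> * A \<iota> \<omega>) f - manova_integral \<alpha> \<beta> f\<bar> > \<epsilon>}
                    \<in> sets (M \<iota>)) \<and>
              (\<lambda>\<iota>. measure (M \<iota>) {\<omega> \<in> space (M \<iota>).
                     \<bar>esd_integral (A \<iota> \<omega> * B \<iota> \<omega> * A \<iota> \<omega>) f - manova_integral \<alpha> \<beta> f\<bar> > \<epsilon>})
                \<longlonglongrightarrow> 0)"
proof -
  interpret random_projections \<alpha> \<beta> M N A B
    by (intro random_projections.intro manova_params.intro random_projections_axioms.intro) (fact assms)+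
  fix f :: "real \<Rightarrow> real"
  assume f: "continuous_on UNIV f"
  show "\<forall>\<epsilon>>0.
              (\<forall>\<iota>. {\<omega> \<in> space (M \<iota>).
                     \<bar>esd_integral (A \<iota> \<omega> * B \<iota> \<omega> * A \<iota> \<omega>) f - manova_integral \<alpha> \<beta> f\<bar> > \<epsilon>}
                    \<in> sets (M \<iota>)) \<and>
              (\<lambda>\<iota>. measure (M \<iota>) {\<omega> \<in> space (M \<iota>).
                     \<bar>esd_integral (A \<iota> \<omega> * B \<iota> \<omega> * A \<iota> \<omega>) f - manova_integral \<alpha> \<beta> f\<bar> > \<epsilon>})
                \<longlonglongrightarrow> 0"
    using deviation_measurable[OF f] convergence_in_probability[OF f] unfolding E_def by simp
qed

end
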